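(* The vertex-Turán density of $Q_6$ is greater than $6/7$. Equivalently, $\gamma_6 < 1/7$.
   Context: Let $Q_n$ denote the $n$-dimensional discrete cube with vertex set $\{0,1\}^n$, two vectors being adjacent if they differ in exactly one coordinate. A copy of $Q_d$ in $Q_n$ is the vertex set of a $d$-dimensional subcube, i.e. a set of the form $\{x \in \{0,1\}^n : x_i = a_i \text{ for all } i \notin I\}$ for some $I \subset [n]$ with $|I| = d$ and some fixed values $a_i \in \{0,1\}$. Let $\mathrm{exc}(n,Q_d)$ be the maximum size of a subset of $\{0,1\}^n$ containing no copy of $Q_d$, and define the vertex-Turán density $\lambda(Q_d) = \lim_{n\to\infty} \mathrm{exc}(n,Q_d)/2^n$ (this limit exists). Let $g(n,d)$ be the minimum size of a subset of $\{0,1\}^n$ that intersects every copy of $Q_d$, and $\gamma_d = \lim_{n\to\infty} g(n,d)/2^n$, so that $\gamma_d = 1 - \lambda(Q_d)$. *)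

theory Defs
  imports Complex_Main "HOL-Library.FuncSet"
begin

definition cube :: "nat \<Rightarrow> (nat \<Rightarrow> nat) set" where
  "cube n = {1..n} \<rightarrow>\<^sub>E {0, 1}"

definition subcubes :: "nat \<Rightarrow> nat \<Rightarrow> (nat \<Rightarrow> nat) set set" where
  "subcubes n d =
     {{x \<in> cube n. \<forall>i\<in>{1..n} - I. x i = a i} | I a.
        I \<subseteq> {1..n} \<and> card I = d \<and> a \<in> {1..n} - I \<rightarrow> {0, 1}}"

definition exc :: "nat \<Rightarrow> nat \<Rightarrow> nat" where
  "exc n d = Max {card A | A. A \<subseteq> cube n \<and> (\<forall>C\<in>subcubes n d. \<not> C \<subseteq> A)}"

definition hitting_number :: "nat \<Rightarrow> nat \<Rightarrow> nat" where
  "hitting_number n d =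
     Min {card A | A. A \<subseteq> cube n \<and> (\<forall>C\<in>subcubes n d. A \<inter> C \<noteq> {})}"

definition vertex_turan_density :: "nat \<Rightarrow> real" where
  "vertex_turan_density d = lim (\<lambda>n. real (exc n d) / 2 ^ n)"

definition hitting_density :: "nat \<Rightarrow> real" where
  "hitting_density d = lim (\<lambda>n. real (hitting_number n d) / 2 ^ n)"

text \<open>
  Since \<^const>\<open>lim\<close> is unspecified on divergent sequences, the following facts show that
  both densities are genuine limits.
\<close>

lemma finite_cube: "finite (cube n)"
  by (simp add: cube_def finite_PiE)

lemma card_cube: "card (cube n) = 2 ^ n"
  by (simp add: cube_def card_PiE numeral_2_eq_2)

lemma subcubes_subset: "C \<in> subcubes n d \<Longrightarrow> C \<subseteq> cube n"
  by (auto simp: subcubes_def)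

lemma subcubes_nonempty:
  assumes "C \<in> subcubes n d" shows "C \<noteq> {}"
proof -
  obtain I a where C: "C = {x \<in> cube n. \<forall>i\<in>{1..n} - I. x i = a i}"
    and a: "a \<in> {1..n} - I \<rightarrow> {0, 1}"
    using assms by (auto simp: subcubes_def)
  have "(\<lambda>i. if i \<in> {1..n} then if i \<in> I then 0 else a i else undefined) \<in> C"
    using a unfolding C cube_def by (auto simp: PiE_iff extensional_def Pi_iff)
  then show ?thesis by blast
qed

lemma finite_card_subsets: "finite {card A | A. A \<subseteq> cube n \<and> P A}"
proof (rule finite_subset)
  show "{card A | A. A \<subseteq> cube n \<and> P A} \<subseteq> card ` Pow (cube n)" by auto
qed (simp add: finite_cube)

lemma exc_upper:
  assumes "A \<subseteq> cube n" "\<forall>C\<in>subcubes n d. \<not> C \<subseteq> A"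
  shows "card A \<le> exc n d"
  unfolding exc_def using assms by (intro Max_ge finite_card_subsets) blast

lemma exc_attained:
  obtains A where "A \<subseteq> cube n" "\<forall>C\<in>subcubes n d. \<not> C \<subseteq> A" "card A = exc n d"
proof -
  have "{} \<subseteq> cube n \<and> (\<forall>C\<in>subcubes n d. \<not> C \<subseteq> {})"
    using subcubes_nonempty by auto
  then have "exc n d \<in> {card A | A. A \<subseteq> cube n \<and> (\<forall>C\<in>subcubes n d. \<not> C \<subseteq> A)}"
    unfolding exc_def by (intro Max_in finite_card_subsets) blast
  then show ?thesis using that by auto
qed

lemma hitting_number_lower:
  assumes "A \<subseteq> cube n" "\<forall>C\<in>subcubes n d. A \<inter> C \<noteq> {}"
  shows "hitting_number n d \<le> card A"
  unfolding hitting_number_def using assms by (intro Min_le finite_card_subsets) blast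

lemma hitting_number_attained:
  obtains A where "A \<subseteq> cube n" "\<forall>C\<in>subcubes n d. A \<inter> C \<noteq> {}"
    "card A = hitting_number n d"
proof -
  have "cube n \<subseteq> cube n \<and> (\<forall>C\<in>subcubes n d. cube n \<inter> C \<noteq> {})"
    using subcubes_nonempty[of _ n d] subcubes_subset[of _ n d] by (simp add: Int_absorb1)
  then have "hitting_number n d \<in> {card A | A. A \<subseteq> cube n \<and> (\<forall>C\<in>subcubes n d. A \<inter> C \<noteq> {})}"
    unfolding hitting_number_def by (intro Min_in finite_card_subsets) blast
  then show ?thesis using that by auto
qed

lemma exc_add_hitting_number: "exc n d + hitting_number n d = 2 ^ n"
proof (rule antisym)
  obtain A where A: "A \<subseteq> cube n" "\<forall>C\<in>subcubes n d. \<not> C \<subseteq> A" "card A = exc n d"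
    by (rule exc_attained)
  have "\<forall>C\<in>subcubes n d. (cube n - A) \<inter> C \<noteq> {}"
  proof
    fix C assume C: "C \<in> subcubes n d"
    with A(2) have "\<not> C \<subseteq> A" by (rule bspec)
    then show "(cube n - A) \<inter> C \<noteq> {}" using subcubes_subset[OF C] by auto
  qed
  then have "hitting_number n d \<le> card (cube n - A)"
    by (intro hitting_number_lower) auto
  also have "\<dots> = 2 ^ n - exc n d"
    using A finite_subset[OF A(1) finite_cube] by (simp add: card_Diff_subset card_cube)
  finally show "exc n d + hitting_number n d \<le> 2 ^ n"
    using card_mono[OF finite_cube A(1)] A(3) by (simp add: card_cube)
  obtain B where B: "B \<subseteq> cube n" "\<forall>C\<in>subcubes n d. B \<inter> C \<noteq> {}"
    "card B = hitting_number n d"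
    by (rule hitting_number_attained)
  have "card (cube n - B) \<le> exc n d"
  proof (rule exc_upper)
    show "\<forall>C\<in>subcubes n d. \<not> C \<subseteq> cube n - B"
    proof
      fix C assume "C \<in> subcubes n d"
      with B(2) have "B \<inter> C \<noteq> {}" by (rule bspec)
      then show "\<not> C \<subseteq> cube n - B" by auto
    qed
  qed simp
  moreover have "card (cube n - B) = 2 ^ n - hitting_number n d"
    using B finite_subset[OF B(1) finite_cube] by (simp add: card_Diff_subset card_cube)
  ultimately show "2 ^ n \<le> exc n d + hitting_number n d" by simp
qed

lemma exc_Suc: "exc (Suc n) d \<le> 2 * exc n d"
proof -
  obtain A where A: "A \<subseteq> cube (Suc n)" "\<forall>C\<in>subcubes (Suc n) d. \<not> C \<subseteq> A"
    "card A = exc (Suc n) d"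
    by (rule exc_attained)
  define B where "B b = {y \<in> cube n. y(Suc n := b) \<in> A}" for b
  have B: "card (B b) \<le> exc n d" if b: "b \<in> {0, 1}" for b
  proof (rule exc_upper)
    show "B b \<subseteq> cube n" by (auto simp: B_def)
    show "\<forall>C\<in>subcubes n d. \<not> C \<subseteq> B b"
    proof (intro ballI notI)
      fix C assume C: "C \<in> subcubes n d" "C \<subseteq> B b"
      obtain I a where Ia: "C = {x \<in> cube n. \<forall>i\<in>{1..n} - I. x i = a i}"
        "I \<subseteq> {1..n}" "card I = d" "a \<in> {1..n} - I \<rightarrow> {0, 1}"
        using C(1) by (auto simp: subcubes_def)
      define a' where "a' = a(Suc n := b)"
      define C' where "C' = {x \<in> cube (Suc n). \<forall>i\<in>{1..Suc n} - I. x i = a' i}"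
      have "I \<subseteq> {1..Suc n}" "a' \<in> {1..Suc n} - I \<rightarrow> {0, 1}"
        using Ia b by (auto simp: a'_def Pi_iff)
      then have "C' \<in> subcubes (Suc n) d"
        using Ia(3) unfolding subcubes_def C'_def by blast
      moreover have "C' \<subseteq> A"
      proof
        fix x assume x: "x \<in> C'"
        have "Suc n \<notin> I" using Ia(2) by auto
        then have xb: "x (Suc n) = b"
          using x \<open>Suc n \<notin> I\<close> by (simp add: C'_def a'_def)
        have "x(Suc n := undefined) \<in> cube n"
          using x by (auto simp: C'_def cube_def PiE_iff extensional_def)
        moreover have "\<forall>i\<in>{1..n} - I. x i = a i"
          using x by (auto simp: C'_def a'_def)
        ultimately have "x(Suc n := undefined) \<in> C"
          by (auto simp: Ia(1))
        then have "x(Suc n := undefined, Suc n := b) \<in> A"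
          using C(2) unfolding B_def by blast
        then show "x \<in> A" using xb by (simp add: fun_upd_idem)
      qed
      ultimately show False using A(2) by blast
    qed
  qed
  have "A \<subseteq> (\<lambda>y. y(Suc n := 0)) ` B 0 \<union> (\<lambda>y. y(Suc n := 1)) ` B 1"
  proof
    fix x assume x: "x \<in> A"
    then have xc: "x \<in> cube (Suc n)" using A(1) by blast
    then have y: "x(Suc n := undefined) \<in> cube n"
      by (auto simp: cube_def PiE_iff extensional_def)
    have "x (Suc n) = 0 \<or> x (Suc n) = 1"
      using xc by (auto simp: cube_def PiE_iff)
    moreover have "x \<in> (\<lambda>y. y(Suc n := b)) ` B b" if "x (Suc n) = b" for b
    proof (rule image_eqI)
      show eq: "x = (x(Suc n := undefined))(Suc n := b)"
        by (simp only: fun_upd_upd that[symmetric] fun_upd_triv)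
      show "x(Suc n := undefined) \<in> B b"
        unfolding B_def mem_Collect_eq eq[symmetric] using x y by (rule conjI[rotated])
    qed
    ultimately show "x \<in> (\<lambda>y. y(Suc n := 0)) ` B 0 \<union> (\<lambda>y. y(Suc n := 1)) ` B 1"
      by (metis UnI1 UnI2)
  qed
  moreover have fin: "finite (B b)" for b
    using finite_cube by (simp add: B_def)
  ultimately have "card A \<le> card ((\<lambda>y. y(Suc n := 0)) ` B 0 \<union> (\<lambda>y. y(Suc n := 1)) ` B 1)"
    by (intro card_mono) auto
  also have "\<dots> \<le> card (B 0) + card (B 1)"
    by (rule order_trans[OF card_Un_le add_mono]) (auto intro: card_image_le fin)
  also have "\<dots> \<le> 2 * exc n d" using B[of 0] B[of 1] by simp
  finally show ?thesis by (simp add: A(3))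
qed

lemma vertex_turan_density_tendsto:
  "(\<lambda>n. real (exc n d) / 2 ^ n) \<longlonglongrightarrow> vertex_turan_density d"
proof -
  have "decseq (\<lambda>n. real (exc n d) / 2 ^ n)"
  proof (rule decseq_SucI)
    fix n
    have "real (exc (Suc n) d) \<le> 2 * real (exc n d)"
      using exc_Suc[of n d] by linarith
    then show "real (exc (Suc n) d) / 2 ^ Suc n \<le> real (exc n d) / 2 ^ n"
      by (simp add: field_simps)
  qed
  then have "convergent (\<lambda>n. real (exc n d) / 2 ^ n)"
    by (rule decseq_convergent[where B = 0]) (auto simp: convergent_def)
  then show ?thesis
    by (simp add: vertex_turan_density_def convergent_LIMSEQ_iff)
qed

lemma hitting_density_tendsto:
    "(\<lambda>n. real (hitting_number n d) / 2 ^ n) \<longlonglongrightarrow> hitting_density d"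
  and hitting_density_eq: "hitting_density d = 1 - vertex_turan_density d"
proof -
  have "real (hitting_number n d) / 2 ^ n = 1 - real (exc n d) / 2 ^ n" for n
  proof -
    have "real (exc n d) + real (hitting_number n d) = 2 ^ n"
      using exc_add_hitting_number[of n d]
      by (metis of_nat_add of_nat_numeral of_nat_power)
    then show ?thesis by (simp add: field_simps)
  qed
  then have *: "(\<lambda>n. real (hitting_number n d) / 2 ^ n) \<longlonglongrightarrow> 1 - vertex_turan_density d"
    by (simp add: tendsto_diff vertex_turan_density_tendsto)
  then show "hitting_density d = 1 - vertex_turan_density d"
    unfolding hitting_density_def by (rule limI)
  with * show "(\<lambda>n. real (hitting_number n d) / 2 ^ n) \<longlonglongrightarrow> hitting_density d"
    by simp
qed

end

theory Submission
  imports Defs "HOL-Library.Cardinality" "HOL-Analysis.Product_Vector"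
    "HOL-Computational_Algebra.Polynomial"
begin

text \<open>
  Let \<open>V = F\<^sub>q\<^sup>r\<close> and label every coordinate \<open>i\<close> by a random pair \<open>(m\<^sub>i, n\<^sub>i) \<in> V \<times> V\<close>, read as
  the vector \<open>m\<^sub>i + t n\<^sub>i\<close> over \<open>F\<^sub>q[[t]]\<close>. Call an \<open>r\<close>-set good if the lattice spanned by its labels
  is the preimage of a subspace of \<open>V\<close> of even codimension. The hitting set consists of the bad
  \<open>r\<close>-sets with \<open>r\<close> in a fixed residue class modulo \<open>d - 3\<close>.

  A copy of \<open>Q\<^sub>d\<close> with bottom \<open>R\<close> and directions \<open>X\<close> meets one of these layers in all sets
  \<open>R \<union> Y\<close>, \<open>Y \<subseteq> X\<close>, \<open>|Y| = s\<close>, for some \<open>2 \<le> s \<le> d - 2\<close>. If all of them were good, then the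
  codimension of the span of the \<open>m\<^sub>i\<close>, which changes by at most one when one element is exchanged,
  would be constant. So the determinants of all \<open>R \<union> Y\<close> have the same valuation, and dividing it
  out represents the uniform matroid \<open>U\<^sub>s\<^sub>,\<^sub>d\<close> over \<open>F\<^sub>q\<close>, which is impossible for \<open>d \<ge> 2q - 1\<close>.

  For \<open>q = 3\<close> a set is good with probability greater than \<open>0.5715 > 4/7\<close>, so
  \<open>\<gamma>\<^sub>6 < (1 - 4/7) / 3 = 1/7\<close>. Codimension 0 alone would only give \<open>0.5601 < 4/7\<close>; codimension 2
  closes the gap.
\<close>

section \<open>Vector spaces over finite fields\<close>

lemma card_field_ge_2: "2 \<le> CARD('f :: {finite, field})"
  using card_mono[of UNIV "{0, 1 :: 'f}"] by simp

context module
begin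

lemma span_Un_span: "span (span A \<union> B) = span (A \<union> B)"
  by (simp add: span_Un span_span)

lemma span_insert_span: "span (insert x (span A)) = span (insert x A)"
  by (simp add: span_insert span_span)

lemma mem_span_Un_image:
  assumes "finite Y"
  shows "x \<in> span (A \<union> w ` Y) \<longleftrightarrow> (\<exists>c. x - (\<Sum>y\<in>Y. c y *s w y) \<in> span A)"
  using assms
proof (induction Y arbitrary: x)
  case (insert y Y)
  have "x \<in> span (A \<union> w ` insert y Y) \<longleftrightarrow> (\<exists>k. x - k *s w y \<in> span (A \<union> w ` Y))"
    by (simp add: span_breakdown_eq)
  also have "\<dots> \<longleftrightarrow> (\<exists>k c. x - k *s w y - (\<Sum>z\<in>Y. c z *s w z) \<in> span A)"
    by (simp add: insert.IH)
  also have "\<dots> \<longleftrightarrow> (\<exists>c. x - (\<Sum>z\<in>insert y Y. c z *s w z) \<in> span A)"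
  proof
    assume "\<exists>k c. x - k *s w y - (\<Sum>z\<in>Y. c z *s w z) \<in> span A"
    then obtain k c where kc: "x - k *s w y - (\<Sum>z\<in>Y. c z *s w z) \<in> span A" by blast
    have "(\<Sum>z\<in>Y. (c(y := k)) z *s w z) = (\<Sum>z\<in>Y. c z *s w z)"
      using insert.hyps by (intro sum.cong) auto
    with kc insert.hyps have "x - (\<Sum>z\<in>insert y Y. (c(y := k)) z *s w z) \<in> span A"
      by (simp add: diff_diff_eq)
    then show "\<exists>c. x - (\<Sum>z\<in>insert y Y. c z *s w z) \<in> span A" by blast
  next
    assume "\<exists>c. x - (\<Sum>z\<in>insert y Y. c z *s w z) \<in> span A"
    with insert.hyps show "\<exists>k c. x - k *s w y - (\<Sum>z\<in>Y. c z *s w z) \<in> span A"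
      by (auto simp: diff_diff_eq)
  qed
  finally show ?case .
qed simp

lemma mem_span_Un_image_subset:
  assumes "finite Y" "Z \<subseteq> Y"
    and "v - (\<Sum>y\<in>Y. c y *s w y) \<in> span A" and "\<And>y. y \<in> Y - Z \<Longrightarrow> c y = 0"
  shows "v \<in> span (A \<union> w ` Z)"
proof -
  have "(\<Sum>y\<in>Z. c y *s w y) = (\<Sum>y\<in>Y. c y *s w y)"
    using assms(1,2,4) by (intro sum.mono_neutral_left) auto
  with assms show ?thesis by (metis finite_subset mem_span_Un_image)
qed

end

context vector_space
begin

lemma dim_mono_finite:
  assumes "A \<subseteq> span B" "finite B"
  shows "dim A \<le> dim B"
proof -
  obtain C where C: "C \<subseteq> B" "independent C" "B \<subseteq> span C" "card C = dim B"
    by (rule basis_exists)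
  have "A \<subseteq> span C"
    using assms(1) span_minimal[OF C(3) subspace_span] by (rule subset_trans)
  moreover have "finite C" using C(1) assms(2) by (rule finite_subset)
  ultimately show ?thesis using dim_le_card C(4) by metis
qed

lemma mem_span_of_zero_minor:
  assumes "finite Y"
    and c: "v - (\<Sum>z\<in>Y. c z *s w z) \<in> span A"
    and d: "w x - (\<Sum>z\<in>Y. d z *s w z) \<in> span A"
    and minor: "c y * d y' = c y' * d y" and nonzero: "d y \<noteq> 0"
  shows "v \<in> span (A \<union> w ` insert x (Y - {y, y'}))"
proof -
  define k where "k = c y / d y"
  have "v - k *s w x - (\<Sum>z\<in>Y. (c z - k * d z) *s w z)
      = v - (\<Sum>z\<in>Y. c z *s w z) - k *s (w x - (\<Sum>z\<in>Y. d z *s w z))"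
    by (simp add: scale_left_diff_distrib scale_right_diff_distrib sum_subtractf scale_sum_right)
  also have "\<dots> \<in> span A" by (rule span_diff[OF c span_scale[OF d]])
  finally have combination: "v - k *s w x - (\<Sum>z\<in>Y. (c z - k * d z) *s w z) \<in> span A" .
  have vanishing: "c z - k * d z = 0" if "z \<in> Y - (Y - {y, y'})" for z
    using that nonzero minor by (auto simp: k_def field_simps)
  have "v - k *s w x \<in> span (A \<union> w ` (Y - {y, y'}))"
    by (rule mem_span_Un_image_subset[OF assms(1) _ combination vanishing]) auto
  then show ?thesis by (auto simp: span_breakdown_eq)
qed

end

text \<open>
  The ambient space may have infinite dimension, so that a single type contains subspaces of every
  dimension; finite sets take the place of \<^locale>\<open>finite_dimensional_vector_space\<close>.
\<close>

locale finite_field_vector_space = vector_space scale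
  for scale :: "'f :: {finite, field} \<Rightarrow> 'a :: ab_group_add \<Rightarrow> 'a" (infixr \<open>*s\<close> 75)
begin

lemma card_span_insert:
  assumes "x \<notin> span A"
  shows "card (span (insert x A)) = CARD('f) * card (span A)"
proof -
  have "inj_on (\<lambda>(c, a). c *s x + a) (UNIV \<times> span A)"
  proof (rule inj_onI, clarify)
    fix c a d b assume ab: "a \<in> span A" "b \<in> span A" and eq: "c *s x + a = d *s x + b"
    then have "(c - d) *s x = b - a" by (simp add: algebra_simps)
    then have "(c - d) *s x \<in> span A" using ab by (simp add: span_diff)
    then have "inverse (c - d) *s (c - d) *s x \<in> span A" by (rule span_scale)
    with assms have "c = d" by (cases "c = d") auto
    with eq show "c = d \<and> a = b" by simp
  qed
  moreover have "span (insert x A) = (\<lambda>(c, a). c *s x + a) ` (UNIV \<times> span A)"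
  proof (intro equalityI subsetI)
    fix y assume "y \<in> span (insert x A)"
    then obtain c where "y - c *s x \<in> span A" by (auto simp: span_breakdown_eq)
    then show "y \<in> (\<lambda>(c, a). c *s x + a) ` (UNIV \<times> span A)"
      by (intro image_eqI[of _ _ "(c, y - c *s x)"]) auto
  next
    fix y assume "y \<in> (\<lambda>(c, a). c *s x + a) ` (UNIV \<times> span A)"
    then obtain c a where "y = c *s x + a" "a \<in> span A" by auto
    then have "y - c *s x \<in> span A" by simp
    then show "y \<in> span (insert x A)" unfolding span_breakdown_eq ..
  qed
  ultimately show ?thesis by (simp add: card_image card_cartesian_product)
qed

lemma finite_span:
  assumes "finite A" shows "finite (span A)"
  using assms
proof (induction A)
  case (insert x A)
  have "span (insert x A) \<subseteq> (\<lambda>(c, a). c *s x + a) ` (UNIV \<times> span A)"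
    by (force simp: span_insert)
  then show ?case by (rule finite_subset) (simp add: insert.IH)
qed simp

lemma card_span:
  assumes "finite A"
  shows "card (span A) = CARD('f) ^ dim A"
proof -
  obtain B where B: "B \<subseteq> A" "independent B" "A \<subseteq> span B" "card B = dim A"
    by (rule basis_exists)
  have "finite B" using B(1) assms finite_subset by blast
  then have "card (span B) = CARD('f) ^ card B" using B(2)
  proof (induction B)
    case (insert x B)
    then show ?case by (simp add: independent_insert card_span_insert)
  qed simp
  moreover have "span A = span B"
    using B by (simp add: span_eq span_base subset_iff)
  ultimately show ?thesis using B(4) by simp
qed

lemma dim_insert:
  assumes "finite A"
  shows "dim (insert x A) = (if x \<in> span A then dim A else Suc (dim A))"
proof (cases "x \<in> span A")
  case True
  then have "dim (insert x A) = dim A" by (intro span_eq_dim span_redundant)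
  with True show ?thesis by simp
next
  case False
  then have "CARD('f) ^ dim (insert x A) = CARD('f) ^ Suc (dim A)"
    using assms by (simp add: card_span_insert flip: card_span)
  with False show ?thesis
    using card_field_ge_2[where 'f = 'f] by (simp only: power_inject_exp) simp
qed

lemma dim_empty [simp]: "dim {} = 0"
  using dim_eq_card_independent[OF independent_empty] by simp

lemma dim_zero [simp]: "dim {0} = 0"
  using dim_insert[of "{}" 0] by simp

lemma span_eqI_dim:
  assumes "A \<subseteq> span B" "finite B" "dim B \<le> dim A"
  shows "span A = span B"
proof (rule card_subset_eq)
  have fin: "finite A" using assms finite_span finite_subset by blast
  show "finite (span B)" using assms(2) by (rule finite_span)
  show "span A \<subseteq> span B" using assms(1) by (intro span_minimal) auto
  have "dim A = dim B" using assms dim_mono_finite by (simp add: order_antisym)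
  then show "card (span A) = card (span B)" using fin assms(2) by (simp add: card_span)
qed

lemma dim_Un_image_le:
  assumes "finite A" "finite Y"
  shows "dim (A \<union> w ` Y) \<le> dim A + card Y"
  using assms(2)
proof (induction Y)
  case (insert y Y)
  then show ?case using assms(1) by (simp add: dim_insert)
qed simp

definition independent_over :: "'a set \<Rightarrow> ('i \<Rightarrow> 'a) \<Rightarrow> 'i set \<Rightarrow> bool" where
  "independent_over A w Y \<longleftrightarrow> dim (A \<union> w ` Y) = dim A + card Y"

lemma independent_over_empty: "independent_over A w {}"
  by (simp add: independent_over_def)

lemma independent_over_insert:
  assumes "finite A" "finite Y" "y \<notin> Y"
  shows "independent_over A w (insert y Y) \<longleftrightarrow>
    independent_over A w Y \<and> w y \<notin> span (A \<union> w ` Y)"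
  using assms dim_Un_image_le[of A Y w] by (auto simp: independent_over_def dim_insert)

lemma independent_over_subset:
  assumes "independent_over A w Y" "finite A" "finite Y" "Z \<subseteq> Y"
  shows "independent_over A w Z"
proof -
  have fin: "finite Z" using assms(3,4) finite_subset by blast
  have "A \<union> w ` Y = (A \<union> w ` Z) \<union> w ` (Y - Z)" using assms(4) by auto
  then have "dim A + card Y \<le> dim (A \<union> w ` Z) + card (Y - Z)"
    using assms fin dim_Un_image_le[of "A \<union> w ` Z" "Y - Z" w] by (simp add: independent_over_def)
  moreover have "card (Y - Z) + card Z = card Y"
    using assms(3,4) fin card_mono[OF assms(3,4)] by (simp add: card_Diff_subset)
  ultimately show ?thesis
    using assms(2) fin dim_Un_image_le[of A Z w] by (simp add: independent_over_def)
qed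

lemma basis_over_exists:
  assumes "finite A" "finite X"
  obtains B where "B \<subseteq> X" "independent_over A w B" "span (A \<union> w ` B) = span (A \<union> w ` X)"
  using assms(2)
proof (induction X arbitrary: thesis)
  case empty
  then show ?case by (simp add: independent_over_empty)
next
  case (insert x X)
  obtain B where B: "B \<subseteq> X" "independent_over A w B" "span (A \<union> w ` B) = span (A \<union> w ` X)"
    by (rule insert.IH)
  have fin: "finite B" "x \<notin> B" using B(1) insert.hyps finite_subset by auto
  show ?case
  proof (cases "w x \<in> span (A \<union> w ` B)")
    case True
    then have "span (A \<union> w ` insert x X) = span (A \<union> w ` X)"
      using B(3) by (simp add: span_redundant)
    with B show ?thesis by (intro insert.prems[of B]) auto
  next
    case False
    have "span (A \<union> w ` insert x B) = span (A \<union> w ` insert x X)"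
      using span_insert_span[of "w x" "A \<union> w ` B"] span_insert_span[of "w x" "A \<union> w ` X"] B(3)
      by simp
    with B False fin assms(1) show ?thesis
      by (intro insert.prems[of "insert x B"]) (auto simp: independent_over_insert)
  qed
qed

end

section \<open>Representations of uniform matroids\<close>

lemma zero_minor_exists_wide:
  fixes c :: "'i \<Rightarrow> 'j \<Rightarrow> 'f :: {finite, field}"
  assumes "2 \<le> card I" "CARD('f) \<le> card J"
    and nonzero: "\<And>i j. i \<in> I \<Longrightarrow> j \<in> J \<Longrightarrow> c i j \<noteq> 0"
  obtains i i' j j' where "i \<in> I" "i' \<in> I" "i \<noteq> i'" "j \<in> J" "j' \<in> J" "j \<noteq> j'"
    "c i j * c i' j' = c i j' * c i' j"
proof -
  have "finite I" using assms(1) by (intro card_ge_0_finite) simp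
  then obtain i i' where i: "i \<in> I" "i' \<in> I" "i \<noteq> i'"
    using assms(1) card_le_Suc0_iff_eq[of I] by force
  have "(\<lambda>j. c i j / c i' j) ` J \<subseteq> UNIV - {0}"
    using i nonzero by auto
  then have "card ((\<lambda>j. c i j / c i' j) ` J) \<le> CARD('f) - 1"
    using card_mono[OF finite, of _ "UNIV - {0 :: 'f}"] by simp
  also have "\<dots> < card J"
    using assms(2) card_field_ge_2[where 'f = 'f] by linarith
  finally obtain j j' where j: "j \<in> J" "j' \<in> J" "j \<noteq> j'" "c i j / c i' j = c i j' / c i' j'"
    using pigeonhole unfolding inj_on_def by blast
  then have "c i j * c i' j' = c i j' * c i' j"
    using i nonzero by (simp add: field_simps)
  with i j that show thesis by blast
qed

lemma zero_minor_exists: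
  fixes c :: "'i \<Rightarrow> 'j \<Rightarrow> 'f :: {finite, field}"
  assumes "2 \<le> card I" "2 \<le> card J" "CARD('f) \<le> card I \<or> CARD('f) \<le> card J"
    and nonzero: "\<And>i j. i \<in> I \<Longrightarrow> j \<in> J \<Longrightarrow> c i j \<noteq> 0"
  obtains i i' j j' where "i \<in> I" "i' \<in> I" "i \<noteq> i'" "j \<in> J" "j' \<in> J" "j \<noteq> j'"
    "c i j * c i' j' = c i j' * c i' j"
proof (cases "CARD('f) \<le> card J")
  case True
  with assms(1) show thesis using nonzero that by (rule zero_minor_exists_wide)
next
  case False
  then have "CARD('f) \<le> card I" using assms(3) by blast
  with assms(2) obtain j j' i i' where "j \<in> J" "j' \<in> J" "j \<noteq> j'" "i \<in> I" "i' \<in> I" "i \<noteq> i'"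
    "c i j * c i' j' = c i' j * c i j'"
    by (rule zero_minor_exists_wide[of J I "\<lambda>j i. c i j"]) (use nonzero in auto)
  with that show thesis by (metis mult.commute)
qed

lemma constant_on_subsets:
  assumes "finite X"
    and step: "\<And>Z x x'. Z \<subseteq> X \<Longrightarrow> Suc (card Z) = s \<Longrightarrow> x \<in> X - Z \<Longrightarrow> x' \<in> X - Z \<Longrightarrow>
      f (insert x Z) = f (insert x' Z)"
    and "Y \<subseteq> X" "Y' \<subseteq> X" "card Y = s" "card Y' = s"
  shows "f Y = f Y'"
  using assms(3,5)
proof (induction "card (Y - Y')" arbitrary: Y)
  case 0
  have "finite Y" "finite Y'" using 0 assms finite_subset by blast+
  with 0 assms(6) have "Y = Y'" by (intro card_subset_eq) auto
  then show ?case by simp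
next
  case (Suc k)
  have fin: "finite Y" "finite Y'" using Suc.prems assms finite_subset by blast+
  then have "card (Y' - Y) = card (Y - Y')"
    using Suc.prems assms(6) by (simp add: card_Diff_subset_Int Int_commute)
  then obtain y y' where y: "y \<in> Y - Y'" "y' \<in> Y' - Y"
    using Suc.hyps(2) by (metis card.empty ex_in_conv nat.distinct(1))
  define Z where "Z = Y - {y}"
  have Y: "Y = insert y Z" and Z: "Z \<subseteq> X" "Suc (card Z) = s" "finite Z"
    using Suc.prems fin y card.remove[of Y y] by (auto simp: Z_def)
  have "insert y' Z - Y' = (Y - Y') - {y}" using y by (auto simp: Z_def)
  then have "k = card (insert y' Z - Y')" using Suc.hyps(2) y fin by simp
  moreover have "insert y' Z \<subseteq> X" "card (insert y' Z) = s"
    using Z y assms(4) by (auto simp: Z_def)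
  ultimately have "f (insert y' Z) = f Y'" by (rule Suc.hyps(1))
  moreover have "f Y = f (insert y' Z)"
    unfolding Y using Z y Suc.prems(1) assms(4) by (intro step) (auto simp: Z_def)
  ultimately show ?case by simp
qed

context finite_field_vector_space
begin

text \<open>Under these hypotheses \<open>w\<close> represents \<open>U\<^sub>s\<^sub>,\<^sub>X\<close> modulo the span of \<open>A\<close>.\<close>

lemma uniform_matroid_not_representable:
  assumes fin: "finite A" "finite X"
    and s: "2 \<le> s" "s + 2 \<le> card X" "CARD('f) \<le> s \<or> CARD('f) + s \<le> card X"
    and indep: "\<And>Y. Y \<subseteq> X \<Longrightarrow> card Y = s \<Longrightarrow> independent_over A w Y"
    and span: "\<And>Y. Y \<subseteq> X \<Longrightarrow> card Y = s \<Longrightarrow> w ` X \<subseteq> span (A \<union> w ` Y)"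
  shows False
proof -
  obtain Y where Y: "Y \<subseteq> X" "card Y = s" "finite Y"
    using s(2) obtain_subset_with_card_n[of s X] by (metis add_leD1)
  have "\<exists>c. w x - (\<Sum>y\<in>Y. c y *s w y) \<in> span A" if "x \<in> X" for x
    using that span[OF Y(1,2)] mem_span_Un_image[OF Y(3), of "w x" A w] by blast
  then obtain c where c: "w x - (\<Sum>y\<in>Y. c x y *s w y) \<in> span A" if "x \<in> X" for x
    by metis
  have not_span: "w x \<notin> span (A \<union> w ` Z)" if "Z \<subseteq> X" "x \<in> X - Z" "Suc (card Z) = s" for x Z
  proof -
    have "finite Z" using that(1) fin(2) by (rule finite_subset)
    then show ?thesis
      using that fin(1) indep[of "insert x Z"] by (simp add: independent_over_insert)
  qed
  have "c x y \<noteq> 0" if "x \<in> X - Y" "y \<in> Y" for x y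
  proof
    assume "c x y = 0"
    then have "w x \<in> span (A \<union> w ` (Y - {y}))"
      using that by (intro mem_span_Un_image_subset[OF Y(3) _ c]) auto
    moreover have "Suc (card (Y - {y})) = s" using that Y by (metis card.remove)
    ultimately show False using not_span[of "Y - {y}" x] that Y(1) by blast
  qed
  moreover have "card (X - Y) = card X - s" using Y by (simp add: card_Diff_subset)
  then have "2 \<le> card (X - Y)" "2 \<le> card Y" "CARD('f) \<le> card (X - Y) \<or> CARD('f) \<le> card Y"
    using s Y(2) by auto
  ultimately obtain x x' y y' where x: "x \<in> X - Y" "x' \<in> X - Y" "x \<noteq> x'"
    and y: "y \<in> Y" "y' \<in> Y" "y \<noteq> y'" and minor: "c x y * c x' y' = c x y' * c x' y"
    and nonzero: "c x' y \<noteq> 0"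
    using zero_minor_exists[of "X - Y" Y c] by metis
  have "w x \<in> span (A \<union> w ` insert x' (Y - {y, y'}))"
    using x by (intro mem_span_of_zero_minor[OF Y(3) c c minor nonzero]) auto
  moreover have "Suc (card (insert x' (Y - {y, y'}))) = s"
    using Y x y card_Diff_subset[of "{y, y'}" Y] s(1) by simp
  ultimately show False using not_span[of "insert x' (Y - {y, y'})" x] x Y(1) by auto
qed

lemma dim_eq_of_even_dim:
  assumes fin: "finite A" "finite X"
    and even: "\<And>Y. Y \<subseteq> X \<Longrightarrow> card Y = s \<Longrightarrow> even (k + dim (A \<union> w ` Y))"
    and "Y \<subseteq> X" "Y' \<subseteq> X" "card Y = s" "card Y' = s"
  shows "dim (A \<union> w ` Y) = dim (A \<union> w ` Y')"
proof (rule constant_on_subsets[OF fin(2) _ assms(4-)])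
  fix Z x x' assume Z: "Z \<subseteq> X" "Suc (card Z) = s" "x \<in> X - Z" "x' \<in> X - Z"
  have finZ: "finite Z" using Z(1) fin(2) by (rule finite_subset)
  have "even (dim (A \<union> w ` insert x Z)) \<longleftrightarrow> even (dim (A \<union> w ` insert x' Z))"
    using even[of "insert x Z"] even[of "insert x' Z"] Z finZ by simp
  then show "dim (A \<union> w ` insert x Z) = dim (A \<union> w ` insert x' Z)"
    using fin(1) finZ by (simp add: dim_insert split: if_splits)
qed

lemma spanning_or_independent:
  assumes fin: "finite A" "finite X" and s: "s \<le> card X"
    and dim_eq: "\<And>Y Y'. Y \<subseteq> X \<Longrightarrow> Y' \<subseteq> X \<Longrightarrow> card Y = s \<Longrightarrow> card Y' = s \<Longrightarrow>
      dim (A \<union> w ` Y) = dim (A \<union> w ` Y')"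
  shows "(\<forall>Y\<subseteq>X. card Y = s \<longrightarrow> span (A \<union> w ` Y) = span (A \<union> w ` X)) \<or>
    (\<forall>Y\<subseteq>X. card Y = s \<longrightarrow> independent_over A w Y)"
proof -
  obtain B where B: "B \<subseteq> X" "independent_over A w B" "span (A \<union> w ` B) = span (A \<union> w ` X)"
    by (rule basis_over_exists[OF fin])
  show ?thesis
  proof (cases "card B \<le> s")
    case True
    then obtain Y0 where Y0: "B \<subseteq> Y0" "Y0 \<subseteq> X" "card Y0 = s"
      using exists_subset_between[OF True s B(1) fin(2)] by blast
    have "span (A \<union> w ` X) \<subseteq> span (A \<union> w ` Y0)"
      unfolding B(3)[symmetric] using Y0(1) by (intro span_mono) auto
    then have Y0_dim: "dim (A \<union> w ` X) \<le> dim (A \<union> w ` Y0)"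
      using fin finite_subset[OF Y0(2)] span_superset[of "A \<union> w ` X"] by (intro dim_mono_finite) auto
    have "span (A \<union> w ` Y) = span (A \<union> w ` X)" if "Y \<subseteq> X" "card Y = s" for Y
    proof (rule span_eqI_dim)
      show "A \<union> w ` Y \<subseteq> span (A \<union> w ` X)" using that(1) span_superset[of "A \<union> w ` X"] by blast
      show "dim (A \<union> w ` X) \<le> dim (A \<union> w ` Y)"
        using Y0_dim dim_eq[OF that(1) Y0(2) that(2) Y0(3)] by simp
    qed (use fin in simp)
    then show ?thesis by blast
  next
    case False
    then obtain Y0 where Y0: "Y0 \<subseteq> B" "card Y0 = s"
      using obtain_subset_with_card_n[of s B] by (metis nle_le)
    have "finite B" using B(1) fin(2) by (rule finite_subset)
    then have "independent_over A w Y0" using B(2) fin(1) Y0(1) independent_over_subset by blast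
    moreover have "Y0 \<subseteq> X" using Y0(1) B(1) by blast
    ultimately have "independent_over A w Y" if "Y \<subseteq> X" "card Y = s" for Y
      using dim_eq[OF that(1) _ that(2) Y0(2)] that(2) Y0(2) by (simp add: independent_over_def)
    then show ?thesis by blast
  qed
qed

end

section \<open>Counting subspaces and spanning families\<close>

lemma card_eq_sum_card_fibres:
  assumes "finite A" "finite B" "g ` A \<subseteq> B"
  shows "card A = (\<Sum>b\<in>B. card {a \<in> A. g a = b})"
  using sum.group[OF assms, of "\<lambda>_. 1 :: nat"] by simp

lemma card_PiE_insert_Collect:
  assumes "finite S" "x \<notin> S" "finite W"
  shows "card {w \<in> insert x S \<rightarrow>\<^sub>E W. P w} = (\<Sum>v\<in>S \<rightarrow>\<^sub>E W. card {a \<in> W. P (v(x := a))})"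
proof -
  have "bij_betw (\<lambda>(v, a). v(x := a)) (SIGMA v:S \<rightarrow>\<^sub>E W. {a \<in> W. P (v(x := a))})
      {w \<in> insert x S \<rightarrow>\<^sub>E W. P w}"
    by (rule bij_betwI[where g = "\<lambda>w. (w(x := undefined), w x)"])
      (use assms(2) in \<open>auto simp: PiE_iff extensional_def fun_eq_iff\<close>)
  then show ?thesis
    using assms(1,3) by (simp add: bij_betw_same_card[symmetric] finite_PiE)
qed

text \<open>The proportion of invertible matrices among the \<open>n \<times> n\<close> matrices over \<open>F\<^sub>q\<close>.\<close>

definition gl_density :: "nat \<Rightarrow> nat \<Rightarrow> real" where
  "gl_density q n = (\<Prod>k<n. 1 - 1 / q ^ Suc k)"

lemma gl_density_0: "gl_density q 0 = 1"
  and gl_density_Suc: "gl_density q (Suc n) = gl_density q n * (1 - 1 / q ^ Suc n)"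
  by (simp_all add: gl_density_def)

lemma gl_density_pos:
  assumes "2 \<le> q" shows "0 < gl_density q n"
proof -
  have "1 / real q ^ Suc k < 1" for k
    using assms one_less_power[of "real q" "Suc k"] by (simp add: divide_less_eq_1 del: power_Suc)
  then show ?thesis
    unfolding gl_density_def by (intro prod_pos) (simp del: power_Suc)
qed

lemma gl_density_ge:
  assumes "2 \<le> q" "m \<le> n"
  shows "gl_density q m * (1 - 1 / ((real q - 1) * real q ^ m)) \<le> gl_density q n"
proof -
  define t where "t k = 1 / ((real q - 1) * real q ^ k)" for k
  have q: "1 < real q" using assms(1) by simp
  have t_mono: "t n \<le> t m" if "m \<le> n" for n
    using q that by (auto simp: t_def intro!: divide_left_mono mult_left_mono power_increasing)
  have "gl_density q m * (1 - t m + t n) \<le> gl_density q n"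
    \<comment> \<open>The summand \<open>t n\<close> makes the induction go through.\<close>
    using assms(2)
  proof (induction n rule: dec_induct)
    case (step n)
    define x where "x = 1 / real q ^ Suc n"
    have x: "0 \<le> x" "x \<le> 1" using q one_le_power[of "real q" "Suc n"]
      by (simp_all add: x_def divide_le_eq_1 del: power_Suc)
    have "t n = real q * t (Suc n)" "x = (real q - 1) * t (Suc n)"
      using q by (simp_all add: t_def x_def)
    then have "t n - t (Suc n) = x" by (simp add: left_diff_distrib)
    then have "(1 - t m + t n) * (1 - x) = 1 - t m + t (Suc n) + x * (t m - t n)"
      by (simp add: algebra_simps)
    then have "1 - t m + t (Suc n) \<le> (1 - t m + t n) * (1 - x)"
      using x(1) t_mono[OF step.hyps(1)] by simp
    then have "gl_density q m * (1 - t m + t (Suc n)) \<le> gl_density q m * (1 - t m + t n) * (1 - x)"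
      using gl_density_pos[OF assms(1), of m] by simp
    also have "\<dots> \<le> gl_density q n * (1 - x)"
      using step.IH x(2) by (intro mult_right_mono) auto
    finally show ?case by (simp add: gl_density_Suc x_def)
  qed simp
  moreover have "gl_density q m * (1 - t m) \<le> gl_density q m * (1 - t m + t n)"
    using gl_density_pos[OF assms(1), of m] q by (intro mult_left_mono) (auto simp: t_def)
  ultimately show ?thesis by (simp add: t_def)
qed

context finite_field_vector_space
begin

lemma gl_density_field_pos: "0 < gl_density CARD('f) n"
  using card_field_ge_2[where 'f = 'f] by (rule gl_density_pos)

lemma card_subspace: "finite W \<Longrightarrow> subspace W \<Longrightarrow> card W = CARD('f) ^ dim W"
  by (metis card_span span_eq_iff)

lemma independent_over_fun_upd:
  assumes "finite B" "finite S" "x \<notin> S"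
  shows "independent_over B (v(x := a)) (insert x S) \<longleftrightarrow>
    independent_over B v S \<and> a \<notin> span (B \<union> v ` S)"
proof -
  have "(v(x := a)) ` S = v ` S" using assms(3) by auto
  then show ?thesis
    using independent_over_insert[OF assms, of "v(x := a)"]
    by (simp only: independent_over_def[of _ _ S] fun_upd_same)
qed

lemma card_independent_extensions:
  assumes W: "finite W" "subspace W" and B: "B \<subseteq> W" and S: "finite S" "x \<notin> S"
    and v: "v \<in> S \<rightarrow>\<^sub>E W" "independent_over B v S"
  shows "real (card {a \<in> W. independent_over B (v(x := a)) (insert x S)}) =
    real CARD('f) ^ dim W - real CARD('f) ^ (dim B + card S)"
proof -
  have finB: "finite B" using B W(1) by (rule finite_subset)
  have span_W: "span (B \<union> v ` S) \<subseteq> W"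
    using v(1) B by (intro span_minimal W) (auto simp: PiE_iff)
  have "{a \<in> W. independent_over B (v(x := a)) (insert x S)} = W - span (B \<union> v ` S)"
    using v(2) by (auto simp: independent_over_fun_upd[OF finB S])
  then have "real (card {a \<in> W. independent_over B (v(x := a)) (insert x S)})
      = real (card W) - real (card (span (B \<union> v ` S)))"
    using card_mono[OF W(1) span_W] finite_subset[OF span_W W(1)] span_W
    by (simp add: card_Diff_subset)
  then show ?thesis
    using v(2) W finB S(1) by (simp add: card_span card_subspace independent_over_def)
qed

lemma card_independent_functions:
  assumes W: "finite W" "subspace W" and B: "B \<subseteq> W" and S: "finite S" "dim B + card S \<le> dim W"
  shows "real (card {w \<in> S \<rightarrow>\<^sub>E W. independent_over B w S}) =
    real CARD('f) ^ (dim W * card S) * gl_density CARD('f) (dim W - dim B) /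
      gl_density CARD('f) (dim W - dim B - card S)"
  using S
proof (induction S)
  case empty
  then show ?case
    using gl_density_field_pos[of "dim W - dim B"] by (simp add: independent_over_empty)
next
  case (insert x S)
  let ?\<phi> = "gl_density CARD('f)"
  define q where "q = real CARD('f)"
  define m where "m = dim W - dim B - Suc (card S)"
  have dim_W: "dim W = dim B + card S + Suc m" using insert by (simp add: m_def)
  have finB: "finite B" using B W(1) by (rule finite_subset)
  have extensions: "real (card {a \<in> W. independent_over B (v(x := a)) (insert x S)}) =
      (q ^ dim W - q ^ (dim B + card S)) * of_bool (independent_over B v S)" if "v \<in> S \<rightarrow>\<^sub>E W" for v
    using card_independent_extensions[OF W B insert.hyps that]
    by (cases "independent_over B v S")
      (simp_all add: independent_over_fun_upd[OF finB insert.hyps] q_def)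
  have "real (card {w \<in> insert x S \<rightarrow>\<^sub>E W. independent_over B w (insert x S)}) =
      (\<Sum>v\<in>S \<rightarrow>\<^sub>E W. (q ^ dim W - q ^ (dim B + card S)) * of_bool (independent_over B v S))"
    unfolding card_PiE_insert_Collect[OF insert.hyps W(1)] of_nat_sum
    by (rule sum.cong[OF refl extensions])
  also have "\<dots> = (q ^ dim W - q ^ (dim B + card S)) * card {v \<in> S \<rightarrow>\<^sub>E W. independent_over B v S}"
    using insert.hyps W(1) by (simp add: finite_PiE sum_distrib_left[symmetric] Collect_conj_eq)
  also have "q ^ dim W - q ^ (dim B + card S) = q ^ dim W * (1 - 1 / q ^ Suc m)"
    by (simp add: q_def dim_W power_add field_simps)
  also have "real (card {v \<in> S \<rightarrow>\<^sub>E W. independent_over B v S}) =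
      q ^ (dim W * card S) * ?\<phi> (dim W - dim B) / ?\<phi> (Suc m)"
    using insert.IH dim_W by (simp add: q_def)
  also have "q ^ dim W * (1 - 1 / q ^ Suc m) * \<dots> =
      q ^ (dim W * card (insert x S)) * ?\<phi> (dim W - dim B) / ?\<phi> m"
    using insert.hyps gl_density_field_pos[of "Suc m"] gl_density_field_pos[of m]
    by (simp add: gl_density_Suc power_add field_simps q_def)
  finally show ?case by (simp add: q_def m_def insert.hyps)
qed

lemma card_spanning_functions:
  assumes W: "finite W" "subspace W" and B: "B \<subseteq> W" and S: "finite S" "dim B + card S = dim W"
  shows "real (card {w \<in> S \<rightarrow>\<^sub>E W. span (B \<union> w ` S) = W}) =
    real CARD('f) ^ (dim W * card S) * gl_density CARD('f) (card S)"
proof -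
  have "span (B \<union> w ` S) = W \<longleftrightarrow> independent_over B w S" if w: "w \<in> S \<rightarrow>\<^sub>E W" for w
  proof
    assume "span (B \<union> w ` S) = W"
    then show "independent_over B w S" using S(2) by (metis dim_span independent_over_def)
  next
    assume "independent_over B w S"
    then have "span (B \<union> w ` S) = span W"
      using w B W S(2)
      by (intro span_eqI_dim) (auto simp: PiE_iff independent_over_def intro: span_base)
    then show "span (B \<union> w ` S) = W" using W(2) by simp
  qed
  then have "{w \<in> S \<rightarrow>\<^sub>E W. span (B \<union> w ` S) = W} = {w \<in> S \<rightarrow>\<^sub>E W. independent_over B w S}" by blast
  then show ?thesis
    using card_independent_functions[OF W B S(1)] S(2)[symmetric] by (simp add: gl_density_0)
qed

lemma independent_spanning_functions:
  assumes "U \<subseteq> V" "dim U = card T"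
  shows "{w \<in> T \<rightarrow>\<^sub>E V. independent_over {} w T \<and> span (w ` T) = U} =
    {w \<in> T \<rightarrow>\<^sub>E U. span (w ` T) = U}"
proof -
  have "w \<in> T \<rightarrow>\<^sub>E V \<and> independent_over {} w T \<longleftrightarrow> w \<in> T \<rightarrow>\<^sub>E U" if w: "span (w ` T) = U" for w
  proof -
    have "dim (w ` T) = card T" using w assms(2) by (metis dim_span)
    moreover have "w ` T \<subseteq> U" using span_superset[of "w ` T"] w by simp
    ultimately show ?thesis using assms(1) by (auto simp: independent_over_def PiE_iff)
  qed
  then show ?thesis by blast
qed

lemma card_subspaces:
  assumes V: "finite V" "subspace V" and c: "c \<le> dim V"
  shows "real (card {U. subspace U \<and> U \<subseteq> V \<and> dim U + c = dim V}) =
    real CARD('f) ^ (c * (dim V - c)) * gl_density CARD('f) (dim V) /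
      (gl_density CARD('f) c * gl_density CARD('f) (dim V - c))"
proof -
  let ?\<phi> = "gl_density CARD('f)"
  define \<U> where "\<U> = {U. subspace U \<and> U \<subseteq> V \<and> dim U + c = dim V}"
  define q where "q = real CARD('f)"
  define m where "m = dim V - c"
  define I where "I = {w \<in> {..<m} \<rightarrow>\<^sub>E V. independent_over {} w {..<m}}"
  have dim_V: "dim V = m + c" using c by (simp add: m_def)
  have fin: "finite I" "finite \<U>"
    using V(1) finite_subset[of \<U> "Pow V"] by (auto simp: I_def \<U>_def finite_PiE)
  have "span (w ` {..<m}) \<in> \<U>" if "w \<in> I" for w
  proof -
    have "span (w ` {..<m}) \<subseteq> V" using that by (intro span_minimal V) (auto simp: I_def PiE_iff)
    with that show ?thesis using dim_V by (simp add: \<U>_def I_def independent_over_def)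
  qed
  then have "real (card I) = (\<Sum>U\<in>\<U>. real (card {w \<in> I. span (w ` {..<m}) = U}))"
    using card_eq_sum_card_fibres[OF fin, of "\<lambda>w. span (w ` {..<m})"]
    by (simp add: image_subset_iff)
  also have "\<dots> = (\<Sum>U\<in>\<U>. q ^ (m * m) * ?\<phi> m)"
  proof (rule sum.cong[OF refl])
    fix U assume "U \<in> \<U>"
    then have U: "finite U" "subspace U" "U \<subseteq> V" "dim U = m"
      using V(1) dim_V finite_subset by (auto simp: \<U>_def)
    then show "real (card {w \<in> I. span (w ` {..<m}) = U}) = q ^ (m * m) * ?\<phi> m"
      using independent_spanning_functions[OF U(3), of "{..<m}"]
        card_spanning_functions[OF U(1,2), of "{}" "{..<m}"]
      by (simp add: I_def q_def)
  qed
  finally have "real (card \<U>) * (q ^ (m * m) * ?\<phi> m) = q ^ (dim V * m) * ?\<phi> (dim V) / ?\<phi> c"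
    using card_independent_functions[OF V, of "{}" "{..<m}"] dim_V by (simp add: I_def q_def)
  then have "real (card \<U>) = q ^ (c * m) * ?\<phi> (dim V) / (?\<phi> c * ?\<phi> m)"
    using gl_density_field_pos[of c] gl_density_field_pos[of m] unfolding dim_V q_def
    by (simp add: field_simps power_add)
  then show ?thesis by (simp add: \<U>_def m_def q_def)
qed

end

section \<open>Lattices spanned by labels\<close>

context finite_field_vector_space
begin

lemma finite_field_vector_space_prod: "finite_field_vector_space (module_prod.scale scale scale)"
proof -
  interpret vector_space_prod scale scale ..
  show ?thesis ..
qed

interpretation prod: finite_field_vector_space "module_prod.scale scale scale"
  by (rule finite_field_vector_space_prod)

interpretation prod: vector_space_prod scale scale ..

lemma dim_Times:
  assumes "finite A" "subspace A" "finite B" "subspace B"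
  shows "prod.dim (A \<times> B) = dim A + dim B"
proof -
  have "CARD('f) ^ prod.dim (A \<times> B) = card (prod.span (A \<times> B))"
    using assms by (simp add: prod.card_span)
  also have "prod.span (A \<times> B) = A \<times> B"
    using prod.subspace_Times[OF assms(2,4)] by (simp only: prod.span_eq_iff)
  also have "card \<dots> = CARD('f) ^ (dim A + dim B)"
    using assms card_span[of A] card_span[of B]
    by (simp add: card_cartesian_product power_add span_eq_iff[THEN iffD2])
  finally show ?thesis using card_field_ge_2[where 'f = 'f] by (simp only: power_inject_exp)
qed

lemma dim_zero_Times:
  assumes "finite B"
  shows "prod.dim ({0} \<times> B) = dim B"
proof -
  have "prod.dim ({0} \<times> B) = prod.dim ({0} \<times> span B)"
    by (metis prod.dim_span prod.span_Times_sing1)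
  also have "\<dots> = dim B"
    using assms finite_span by (simp add: dim_Times)
  finally show ?thesis .
qed

text \<open>
  A pair \<open>(m, n)\<close> stands for \<open>m + t n\<close> modulo \<open>t\<^sup>2\<close>. Adjoining the pairs \<open>(0, m)\<close> makes the span
  closed under multiplication by \<open>t\<close>. A full lattice is the preimage of its reduction modulo \<open>t\<close>.
\<close>

definition lattice :: "('i \<Rightarrow> 'a \<times> 'a) \<Rightarrow> 'i set \<Rightarrow> ('a \<times> 'a) set" where
  "lattice u S = prod.span (u ` S \<union> {0} \<times> fst ` u ` S)"

definition full_lattice :: "'a set \<Rightarrow> ('i \<Rightarrow> 'a \<times> 'a) \<Rightarrow> 'i set \<Rightarrow> bool" where
  "full_lattice V u S \<longleftrightarrow> lattice u S = span (fst ` u ` S) \<times> V"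

definition good :: "'a set \<Rightarrow> ('i \<Rightarrow> 'a \<times> 'a) \<Rightarrow> 'i set \<Rightarrow> bool" where
  "good V u S \<longleftrightarrow> full_lattice V u S \<and> even (dim V + dim (fst ` u ` S))"

lemma lattice_eq_span_Un: "lattice u S = prod.span ({0} \<times> span (fst ` u ` S) \<union> u ` S)"
  unfolding lattice_def prod.span_Times_sing1[symmetric] prod.span_Un_span
  by (simp add: Un_commute)

lemma dim_full_lattice_generators:
  assumes "full_lattice V u S" "finite S" "finite V" "subspace V"
  shows "prod.dim (u ` S \<union> {0} \<times> fst ` u ` S) = dim (fst ` u ` S) + dim V"
proof -
  have "prod.dim (u ` S \<union> {0} \<times> fst ` u ` S) = prod.dim (span (fst ` u ` S) \<times> V)"
    using assms(1) unfolding full_lattice_def lattice_def by (metis prod.dim_span)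
  also have "\<dots> = dim (fst ` u ` S) + dim V"
    using assms(2-4) by (simp add: dim_Times finite_span)
  finally show ?thesis .
qed

lemma dim_t_multiples_ge:
  assumes full: "full_lattice V u (R \<union> Y)" and fin: "finite R" "finite Y" "finite V" "subspace V"
    and indep: "independent_over (fst ` u ` R) (fst \<circ> u) Y"
  shows "dim (fst ` u ` R) + dim V \<le>
    prod.dim ({0} \<times> fst ` u ` R \<union> u ` R \<union> (\<lambda>x. (0, fst (u x))) ` Y)"
    (is "_ \<le> prod.dim ?T")
proof -
  have "dim (fst ` u ` R) + card Y + dim V = dim (fst ` u ` (R \<union> Y)) + dim V"
    using indep by (simp add: independent_over_def image_Un image_comp)
  also have "\<dots> = prod.dim (u ` (R \<union> Y) \<union> {0} \<times> fst ` u ` (R \<union> Y))"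
    using full fin by (simp add: dim_full_lattice_generators)
  also have "u ` (R \<union> Y) \<union> {0} \<times> fst ` u ` (R \<union> Y) = ?T \<union> u ` Y" by auto
  also have "prod.dim \<dots> \<le> prod.dim ?T + card Y"
    using fin by (intro prod.dim_Un_image_le) auto
  finally show ?thesis by simp
qed

context
  fixes V :: "'a set" and u :: "'i \<Rightarrow> 'a \<times> 'a" and R X :: "'i set" and s :: nat
  assumes V: "finite V" "subspace V" and fin: "finite R" "finite X"
    and labels: "u ` (R \<union> X) \<subseteq> V \<times> V"
    and dim_V: "card R + s = dim V"
    and s: "2 \<le> s" "s + 2 \<le> card X" "CARD('f) \<le> s \<or> CARD('f) + s \<le> card X"
begin

lemma not_all_full_lattice_of_spanning:
  assumes full: "\<And>Y. Y \<subseteq> X \<Longrightarrow> card Y = s \<Longrightarrow> full_lattice V u (R \<union> Y)"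
    and span: "\<And>Y. Y \<subseteq> X \<Longrightarrow> card Y = s \<Longrightarrow>
      span (fst ` u ` (R \<union> Y)) = span (fst ` u ` (R \<union> X))"
  shows False
proof -
  define U where "U = span (fst ` u ` (R \<union> X))"
  define A where "A = {0} \<times> U \<union> u ` R"
  have U: "finite U" "subspace U" using fin by (simp_all add: U_def finite_span)
  have UV: "finite (U \<times> V)" "prod.dim (U \<times> V) = dim U + dim V"
    using U V by (simp_all add: dim_Times)
  have A: "finite A" using U fin by (simp add: A_def)
  have dim_A: "prod.dim A \<le> dim U + card R"
    using prod.dim_Un_image_le[of "{0} \<times> U" R u] U(1) fin(1)
    by (simp add: A_def dim_zero_Times)
  have span_A: "prod.span (A \<union> u ` Y) = U \<times> V" if "Y \<subseteq> X" "card Y = s" for Y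
    using full[OF that] span[OF that]
    by (simp add: full_lattice_def lattice_eq_span_Un U_def A_def image_Un Un_assoc)
  show False
  proof (rule prod.uniform_matroid_not_representable[OF A fin(2) s])
    fix Y assume Y: "Y \<subseteq> X" "card Y = s"
    have "prod.dim (A \<union> u ` Y) = dim U + dim V"
      using span_A[OF Y] UV(2) by (metis prod.dim_span)
    then show "prod.independent_over A u Y"
      using prod.dim_Un_image_le[of A Y u] A Y finite_subset[OF Y(1) fin(2)] dim_A dim_V
      by (simp add: prod.independent_over_def)
    have "u x \<in> U \<times> V" if "x \<in> X" for x
      using that labels span_base[of "fst (u x)" "fst ` u ` (R \<union> X)"]
      by (auto simp: U_def mem_Times_iff)
    then show "u ` X \<subseteq> prod.span (A \<union> u ` Y)" using span_A[OF Y] by blast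
  qed
qed

lemma not_all_full_lattice_of_independent:
  assumes full: "\<And>Y. Y \<subseteq> X \<Longrightarrow> card Y = s \<Longrightarrow> full_lattice V u (R \<union> Y)"
    and indep: "\<And>Y. Y \<subseteq> X \<Longrightarrow> card Y = s \<Longrightarrow> independent_over (fst ` u ` R) (fst \<circ> u) Y"
  shows False
proof -
  define M where "M = fst ` u ` R"
  define A where "A = {0} \<times> M \<union> u ` R"
  define w where "w = (\<lambda>x. (0 :: 'a, fst (u x)))"
    \<comment> \<open>\<open>u x\<close> multiplied by \<open>t\<close>\<close>
  have M: "finite M" "M \<subseteq> V" using fin labels by (auto simp: M_def)
  have A: "finite A" using M fin by (simp add: A_def)
  have dim_A: "prod.dim A \<le> dim M + card R"
    using prod.dim_Un_image_le[of "{0} \<times> M" R u] M(1) fin(1)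
    by (simp add: A_def dim_zero_Times)
  have W: "finite (span M \<times> V)" "prod.dim (span M \<times> V) = dim M + dim V"
    using M V by (simp_all add: dim_Times finite_span)
  have fst_V: "fst (u x) \<in> V" if "x \<in> X" for x using that labels by auto
  have uR: "u ` R \<subseteq> span M \<times> V"
    using labels span_superset[of M] by (force simp: M_def)
  have dim_A_Un: "dim M + dim V \<le> prod.dim (A \<union> w ` Y)" if Y: "Y \<subseteq> X" "card Y = s" for Y
    using dim_t_multiples_ge[OF full[OF Y] fin(1) _ V indep[OF Y]] finite_subset[OF Y(1) fin(2)]
    by (simp add: M_def A_def w_def)
  show False
  proof (rule prod.uniform_matroid_not_representable[OF A fin(2) s])
    fix Y assume Y: "Y \<subseteq> X" "card Y = s"
    have finY: "finite Y" using Y(1) fin(2) by (rule finite_subset)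
    show "prod.independent_over A w Y"
      using prod.dim_Un_image_le[of A Y w] A Y(2) finY dim_A_Un[OF Y] dim_A dim_V
      by (simp add: prod.independent_over_def)
    have "A \<union> w ` Y \<subseteq> span M \<times> V"
      using uR Y(1) M fst_V subspace_0[OF V(2)] by (auto simp: A_def w_def span_base span_zero)
    moreover have "prod.span (span M \<times> V) = span M \<times> V"
      using V by (simp add: prod.subspace_Times)
    ultimately have "prod.span (A \<union> w ` Y) = span M \<times> V"
      using prod.span_eqI_dim[of "A \<union> w ` Y" "span M \<times> V"] W dim_A_Un[OF Y] by metis
    then show "w ` X \<subseteq> prod.span (A \<union> w ` Y)"
      using fst_V by (auto simp: w_def span_zero)
  qed
qed

lemma not_all_good: "\<exists>Y\<subseteq>X. card Y = s \<and> \<not> good V u (R \<union> Y)"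
proof (rule ccontr)
  assume "\<not> ?thesis"
  then have good: "good V u (R \<union> Y)" if "Y \<subseteq> X" "card Y = s" for Y using that by blast
  have image: "fst ` u ` (R \<union> Y) = fst ` u ` R \<union> (fst \<circ> u) ` Y" for Y
    by (simp add: image_Un image_comp)
  have "even (dim V + dim (fst ` u ` R \<union> (fst \<circ> u) ` Y))" if "Y \<subseteq> X" "card Y = s" for Y
    using good[OF that] by (simp add: good_def image)
  then have dim_eq: "dim (fst ` u ` R \<union> (fst \<circ> u) ` Y) = dim (fst ` u ` R \<union> (fst \<circ> u) ` Y')"
    if "Y \<subseteq> X" "Y' \<subseteq> X" "card Y = s" "card Y' = s" for Y Y'
    using fin that by (intro dim_eq_of_even_dim[where s = s]) auto
  have "s \<le> card X" using s(2) by simp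
  then consider
      (spanning) "\<forall>Y\<subseteq>X. card Y = s \<longrightarrow>
        span (fst ` u ` R \<union> (fst \<circ> u) ` Y) = span (fst ` u ` R \<union> (fst \<circ> u) ` X)"
    | (independent) "\<forall>Y\<subseteq>X. card Y = s \<longrightarrow> independent_over (fst ` u ` R) (fst \<circ> u) Y"
    using spanning_or_independent[of "fst ` u ` R" X s "fst \<circ> u"] fin dim_eq by blast
  then show False
  proof cases
    case spanning
    then show False
      using good by (intro not_all_full_lattice_of_spanning) (auto simp: good_def image)
  next
    case independent
    then show False
      using good by (intro not_all_full_lattice_of_independent) (auto simp: good_def)
  qed
qed

end

lemma full_lattice_fibre:
  assumes V: "subspace V" and U: "subspace U" "U \<subseteq> V"
  shows "{u \<in> S \<rightarrow>\<^sub>E V \<times> V. full_lattice V u S \<and> span (fst ` u ` S) = U} =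
    {u \<in> S \<rightarrow>\<^sub>E U \<times> V. prod.span ({0} \<times> U \<union> u ` S) = U \<times> V}"
proof (intro Collect_cong iffI conjI; elim conjE)
  fix u assume u: "u \<in> S \<rightarrow>\<^sub>E V \<times> V" and full: "full_lattice V u S"
    and span: "span (fst ` u ` S) = U"
  have "fst (u x) \<in> U" if "x \<in> S" for x
    unfolding span[symmetric] using that by (intro span_base) auto
  with u show "u \<in> S \<rightarrow>\<^sub>E U \<times> V" by (auto simp: PiE_iff mem_Times_iff)
  show "prod.span ({0} \<times> U \<union> u ` S) = U \<times> V"
    using full by (simp add: full_lattice_def lattice_eq_span_Un span)
next
  fix u assume u: "u \<in> S \<rightarrow>\<^sub>E U \<times> V" and span: "prod.span ({0} \<times> U \<union> u ` S) = U \<times> V"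
  show "u \<in> S \<rightarrow>\<^sub>E V \<times> V" using u U(2) by (auto simp: PiE_iff mem_Times_iff)
  have "U = fst ` prod.span ({0} \<times> U \<union> u ` S)"
    using subspace_0[OF V] unfolding span by force
  also have "\<dots> = span (fst ` ({0} \<times> U \<union> u ` S))"
    by (rule module_hom.span_image[symmetric, OF prod.linear_fst[folded module_hom_iff_linear]])
  also have "fst ` ({0} \<times> U \<union> u ` S) = insert 0 (fst ` u ` S)"
    using subspace_0[OF U(1)] by force
  finally show "span (fst ` u ` S) = U" by simp
  then show "full_lattice V u S"
    using span by (simp add: full_lattice_def lattice_eq_span_Un)
qed

lemma card_full_lattice_over:
  assumes V: "finite V" "subspace V" and U: "subspace U" "U \<subseteq> V" and S: "finite S" "card S = dim V"
  shows "real (card {u \<in> S \<rightarrow>\<^sub>E V \<times> V. full_lattice V u S \<and> span (fst ` u ` S) = U}) =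
    real CARD('f) ^ ((dim U + dim V) * dim V) * gl_density CARD('f) (dim V)"
proof -
  have finU: "finite U" using U(2) V(1) by (rule finite_subset)
  have "real (card {u \<in> S \<rightarrow>\<^sub>E U \<times> V. prod.span ({0} \<times> U \<union> u ` S) = U \<times> V}) =
      real CARD('f) ^ (prod.dim (U \<times> V) * card S) * gl_density CARD('f) (card S)"
  proof (rule prod.card_spanning_functions)
    show "prod.subspace (U \<times> V)" using U(1) V(2) by (rule prod.subspace_Times)
    show "{0} \<times> U \<subseteq> U \<times> V" using U by (auto simp: subspace_0)
    show "prod.dim ({0} \<times> U) + card S = prod.dim (U \<times> V)"
      using finU U V S(2) by (simp add: dim_Times dim_zero_Times)
  qed (use finU V S in auto)
  then show ?thesis
    using full_lattice_fibre[OF V(2) U, of S] finU U V S(2) by (simp add: dim_Times)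
qed

lemma card_full_lattice_codim_eq_card_subspaces:
  assumes V: "finite V" "subspace V" and S: "finite S" "card S = dim V"
  shows "real (card {u \<in> S \<rightarrow>\<^sub>E V \<times> V. full_lattice V u S \<and> dim (fst ` u ` S) + c = dim V}) =
    real (card {U. subspace U \<and> U \<subseteq> V \<and> dim U + c = dim V}) *
      (real CARD('f) ^ ((dim V - c + dim V) * dim V) * gl_density CARD('f) (dim V))"
proof -
  define \<U> where "\<U> = {U. subspace U \<and> U \<subseteq> V \<and> dim U + c = dim V}"
  define G where "G = {u \<in> S \<rightarrow>\<^sub>E V \<times> V. full_lattice V u S \<and> dim (fst ` u ` S) + c = dim V}"
  let ?N = "real CARD('f) ^ ((dim V - c + dim V) * dim V) * gl_density CARD('f) (dim V)"
  have fin: "finite G" "finite \<U>"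
    using V(1) S(1) finite_subset[of \<U> "Pow V"] by (auto simp: G_def \<U>_def finite_PiE)
  have "span (fst ` u ` S) \<in> \<U>" if "u \<in> G" for u
  proof -
    have "span (fst ` u ` S) \<subseteq> V" using that by (intro span_minimal V) (auto simp: G_def PiE_iff)
    with that show ?thesis by (simp add: \<U>_def G_def)
  qed
  then have "real (card G) = (\<Sum>U\<in>\<U>. real (card {u \<in> G. span (fst ` u ` S) = U}))"
    using card_eq_sum_card_fibres[OF fin, of "\<lambda>u. span (fst ` u ` S)"]
    by (simp add: image_subset_iff)
  also have "\<dots> = (\<Sum>U\<in>\<U>. ?N)"
  proof (rule sum.cong[OF refl])
    fix U assume "U \<in> \<U>"
    then have U: "subspace U" "U \<subseteq> V" "dim U + c = dim V" by (simp_all add: \<U>_def)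
    have "{u \<in> G. span (fst ` u ` S) = U} =
        {u \<in> S \<rightarrow>\<^sub>E V \<times> V. full_lattice V u S \<and> span (fst ` u ` S) = U}"
      using U(3) by (auto simp: G_def)
    moreover have "dim U = dim V - c" using U(3) by simp
    ultimately show "real (card {u \<in> G. span (fst ` u ` S) = U}) = ?N"
      using card_full_lattice_over[OF V U(1,2) S] by simp
  qed
  also have "\<dots> = real (card \<U>) * ?N" by simp
  finally show ?thesis unfolding G_def \<U>_def .
qed

lemma card_full_lattice_codim:
  assumes V: "finite V" "subspace V" and S: "finite S" "card S = dim V" and c: "c \<le> dim V"
  shows "real (card {u \<in> S \<rightarrow>\<^sub>E V \<times> V. full_lattice V u S \<and> dim (fst ` u ` S) + c = dim V}) =
    real CARD('f) ^ (2 * dim V * dim V) * (gl_density CARD('f) (dim V))\<^sup>2 /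
      (real CARD('f) ^ (c * c) * gl_density CARD('f) c * gl_density CARD('f) (dim V - c))"
proof -
  define q where "q = real CARD('f)"
  define m where "m = dim V - c"
  have dim_V: "dim V = m + c" using c by (simp add: m_def)
  have "c * c + (c * m + (m + dim V) * dim V) = 2 * dim V * dim V"
    by (simp add: dim_V algebra_simps)
  then have "q ^ (c * c) * (q ^ (c * m) * q ^ ((m + dim V) * dim V)) = q ^ (2 * dim V * dim V)"
    by (simp flip: power_add)
  moreover have "q \<noteq> 0" by (simp add: q_def)
  ultimately show ?thesis
    using gl_density_field_pos[of c] gl_density_field_pos[of m]
    unfolding card_full_lattice_codim_eq_card_subspaces[OF V S] card_subspaces[OF V c]
      q_def[symmetric] m_def[symmetric]
    by (simp add: field_simps power2_eq_square)
qed

end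

section \<open>Random labellings\<close>

lemma card_PiE_restrict:
  assumes "finite A" "S \<subseteq> A"
  shows "card {u \<in> A \<rightarrow>\<^sub>E T. P (restrict u S)} = card {v \<in> S \<rightarrow>\<^sub>E T. P v} * card ((A - S) \<rightarrow>\<^sub>E T)"
proof -
  have "bij_betw (\<lambda>u. (restrict u S, restrict u (A - S))) {u \<in> A \<rightarrow>\<^sub>E T. P (restrict u S)}
      ({v \<in> S \<rightarrow>\<^sub>E T. P v} \<times> ((A - S) \<rightarrow>\<^sub>E T))"
  proof (rule bij_betw_byWitness[where f' = "\<lambda>(v, w) i. if i \<in> S then v i else w i"])
    have "restrict (\<lambda>i. if i \<in> S then v i else w i) S = v" if "v \<in> S \<rightarrow>\<^sub>E T" for v w
      using that by (auto simp: fun_eq_iff PiE_iff extensional_def)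
    then show "(\<lambda>(v, w) i. if i \<in> S then v i else w i) ` ({v \<in> S \<rightarrow>\<^sub>E T. P v} \<times> ((A - S) \<rightarrow>\<^sub>E T))
        \<subseteq> {u \<in> A \<rightarrow>\<^sub>E T. P (restrict u S)}"
      using assms(2) by (auto simp: PiE_iff extensional_def)
  qed (use assms(2) in \<open>auto simp: fun_eq_iff PiE_iff extensional_def split: if_splits\<close>)
  then show ?thesis by (simp add: bij_betw_same_card card_cartesian_product)
qed

lemma exists_above_average:
  fixes \<delta> :: real
  assumes "finite \<Omega>" "\<Omega> \<noteq> {}" "finite \<S>"
    and fraction: "\<And>S. S \<in> \<S> \<Longrightarrow> \<delta> * card \<Omega> \<le> card {u \<in> \<Omega>. P u S}"
  obtains u where "u \<in> \<Omega>" "\<delta> * card \<S> \<le> card {S \<in> \<S>. P u S}"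
proof -
  have "(\<Sum>u\<in>\<Omega>. \<delta> * card \<S>) = (\<Sum>S\<in>\<S>. \<delta> * card \<Omega>)" by simp
  also have "\<dots> \<le> (\<Sum>S\<in>\<S>. real (card {u \<in> \<Omega>. P u S}))" by (intro sum_mono fraction)
  also have "\<dots> = (\<Sum>S\<in>\<S>. \<Sum>u\<in>\<Omega>. of_bool (P u S))" using assms(1) by (simp add: Collect_conj_eq)
  also have "\<dots> = (\<Sum>u\<in>\<Omega>. \<Sum>S\<in>\<S>. of_bool (P u S))" by (rule sum.swap)
  also have "\<dots> = (\<Sum>u\<in>\<Omega>. real (card {S \<in> \<S>. P u S}))" using assms(3) by (simp add: Collect_conj_eq)
  finally have "\<exists>u\<in>\<Omega>. \<delta> * card \<S> \<le> card {S \<in> \<S>. P u S}"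
    using assms(1,2) sum_strict_mono[of \<Omega> "\<lambda>u. real (card {S \<in> \<S>. P u S})" "\<lambda>u. \<delta> * card \<S>"]
    by (meson not_le)
  with that show thesis by blast
qed

lemma card_le_of_layers:
  fixes \<delta> :: real
  assumes "finite A" "\<B> \<subseteq> Pow A"
    and layer: "\<And>r. card {S \<in> \<B>. card S = r} \<le> \<delta> * (card A choose r)"
  shows "card \<B> \<le> \<delta> * 2 ^ card A"
proof -
  have "card \<B> = (\<Sum>r\<le>card A. card {S \<in> \<B>. card S = r})"
    using assms(1,2) card_mono[OF assms(1)]
    by (intro card_eq_sum_card_fibres) (auto intro: finite_subset)
  then have "real (card \<B>) \<le> (\<Sum>r\<le>card A. \<delta> * (card A choose r))"
    using layer by (simp add: sum_mono)
  also have "\<dots> = \<delta> * real (\<Sum>r\<le>card A. card A choose r)"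
    by (simp add: sum_distrib_left)
  also have "\<dots> = \<delta> * 2 ^ card A" by (simp only: choose_row_sum) simp
  finally show ?thesis .
qed

text \<open>Only good sets of codimension 0 or 2 are counted.\<close>

definition good_density :: "nat \<Rightarrow> nat \<Rightarrow> real" where
  "good_density q r = gl_density q r +
    (if 2 \<le> r then (gl_density q r)\<^sup>2 / (q ^ 4 * gl_density q 2 * gl_density q (r - 2)) else 0)"

context finite_field_vector_space
begin

lemma card_good_ge:
  assumes V: "finite V" "subspace V" and S: "finite S" "card S = dim V"
  shows "good_density CARD('f) (dim V) * card (S \<rightarrow>\<^sub>E V \<times> V) \<le> card {u \<in> S \<rightarrow>\<^sub>E V \<times> V. good V u S}"
proof -
  let ?\<phi> = "gl_density CARD('f)"
  define G where "G c = {u \<in> S \<rightarrow>\<^sub>E V \<times> V. full_lattice V u S \<and> dim (fst ` u ` S) + c = dim V}" for c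
  have "card (V \<times> V) = CARD('f) ^ (2 * dim V)"
    by (simp add: card_cartesian_product card_subspace[OF V] mult_2 power_add)
  then have card_all: "real (card (S \<rightarrow>\<^sub>E V \<times> V)) = real CARD('f) ^ (2 * dim V * dim V)"
    using S by (simp add: card_PiE power_mult)
  have finG: "finite (G c)" for c using V(1) S(1) by (simp add: G_def finite_PiE)
  have card_G: "real (card (G c)) =
      (?\<phi> (dim V))\<^sup>2 / (real CARD('f) ^ (c * c) * ?\<phi> c * ?\<phi> (dim V - c)) * card (S \<rightarrow>\<^sub>E V \<times> V)"
    if "c \<le> dim V" for c
    using card_full_lattice_codim[OF V S that] card_all by (simp add: G_def)
  have card_G_0: "real (card (G 0)) = ?\<phi> (dim V) * card (S \<rightarrow>\<^sub>E V \<times> V)"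
    using card_G[of 0] gl_density_field_pos[of "dim V"] by (simp add: gl_density_0 power2_eq_square)
  have G_2: "G 2 = {}" if "\<not> 2 \<le> dim V" using that by (auto simp: G_def)
  have "good_density CARD('f) (dim V) * card (S \<rightarrow>\<^sub>E V \<times> V) = real (card (G 0)) + real (card (G 2))"
    using card_G[of 2] G_2 by (simp add: good_density_def card_G_0 distrib_right)
  also have "\<dots> = card (G 0 \<union> G 2)"
  proof -
    have "G 0 \<inter> G 2 = {}" by (auto simp: G_def)
    then show ?thesis using finG by (simp add: card_Un_disjoint)
  qed
  also have "\<dots> \<le> card {u \<in> S \<rightarrow>\<^sub>E V \<times> V. good V u S}"
  proof -
    have "even (dim V + dim W)" if "dim W + c = dim V" "even c" for W c
      using that(2) by (simp flip: that(1))
    then have "G c \<subseteq> {u \<in> S \<rightarrow>\<^sub>E V \<times> V. good V u S}" if "even c" for c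
      using that by (auto simp: G_def good_def simp del: even_add)
    then show ?thesis using V(1) S(1) by (intro of_nat_mono card_mono) (auto simp: finite_PiE)
  qed
  finally show ?thesis .
qed

lemma exists_labelling_with_few_bad:
  assumes V: "finite V" "subspace V" and A: "finite A"
  obtains u where "u \<in> A \<rightarrow>\<^sub>E V \<times> V"
    "card {S. S \<subseteq> A \<and> card S = dim V \<and> \<not> good V u S} \<le>
      (1 - good_density CARD('f) (dim V)) * (card A choose dim V)"
proof -
  define \<Omega> where "\<Omega> = A \<rightarrow>\<^sub>E V \<times> V"
  define \<S> where "\<S> = {S. S \<subseteq> A \<and> card S = dim V}"
  let ?\<delta> = "good_density CARD('f) (dim V)"
  have "finite \<Omega>" using A V(1) by (simp add: \<Omega>_def finite_PiE)
  moreover have "\<Omega> \<noteq> {}" using subspace_0[OF V(2)] by (auto simp: \<Omega>_def PiE_eq_empty_iff)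
  moreover have fin\<S>: "finite \<S>" using A by (auto simp: \<S>_def intro: finite_subset[of _ "Pow A"])
  moreover have "?\<delta> * card \<Omega> \<le> card {u \<in> \<Omega>. good V u S}" if "S \<in> \<S>" for S
  proof -
    have S: "S \<subseteq> A" "card S = dim V" "finite S" using that A finite_subset by (auto simp: \<S>_def)
    have "good V (restrict u S) S \<longleftrightarrow> good V u S" for u
      by (simp add: good_def full_lattice_def lattice_def)
    then have "card {u \<in> \<Omega>. good V u S} =
        card {v \<in> S \<rightarrow>\<^sub>E V \<times> V. good V v S} * card ((A - S) \<rightarrow>\<^sub>E V \<times> V)"
      using card_PiE_restrict[OF A S(1), of "V \<times> V" "\<lambda>v. good V v S"] by (simp add: \<Omega>_def)
    moreover have "card \<Omega> = card (S \<rightarrow>\<^sub>E V \<times> V) * card ((A - S) \<rightarrow>\<^sub>E V \<times> V)"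
      using card_PiE_restrict[OF A S(1), of "V \<times> V" "\<lambda>_. True"] by (simp add: \<Omega>_def)
    ultimately show ?thesis
      using mult_right_mono[OF card_good_ge[OF V S(3,2)], of "real (card ((A - S) \<rightarrow>\<^sub>E V \<times> V))"]
      by (simp add: mult.assoc)
  qed
  ultimately obtain u where u: "u \<in> \<Omega>" "?\<delta> * card \<S> \<le> card {S \<in> \<S>. good V u S}"
    by (rule exists_above_average)
  have "card {S \<in> \<S>. good V u S} + card {S \<in> \<S>. \<not> good V u S} = card \<S>"
    using fin\<S> by (subst card_Un_disjoint[symmetric]) (auto intro: arg_cong[where f = card])
  with u(2) have "card {S \<in> \<S>. \<not> good V u S} \<le> (1 - ?\<delta>) * card \<S>"
    by (simp add: left_diff_distrib)
  then show thesis
    using that u(1) n_subsets[OF A] by (simp add: \<Omega>_def \<S>_def)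
qed

lemma exists_subspace_of_dim:
  assumes "infinite (UNIV :: 'a set)"
  obtains V where "finite V" "subspace V" "dim V = r"
proof (induction r arbitrary: thesis)
  case 0
  show ?case by (rule 0[of "{0}"]) simp_all
next
  case (Suc r)
  obtain V where V: "finite V" "subspace V" "dim V = r" by (rule Suc.IH)
  then obtain x where "x \<notin> V" using assms ex_new_if_finite by blast
  then have "x \<notin> span V" using V(2) by (metis span_eq_iff)
  with V show ?case
    by (intro Suc.prems[of "span (insert x V)"]) (simp_all add: finite_span dim_insert)
qed

definition bad_family :: "'i set \<Rightarrow> (nat \<Rightarrow> 'a set) \<Rightarrow> (nat \<Rightarrow> 'i \<Rightarrow> 'a \<times> 'a) \<Rightarrow> 'i set set" where
  "bad_family A V u = {S. S \<subseteq> A \<and> \<not> good (V (card S)) (u (card S)) S}"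

lemma card_bad_family_le:
  fixes \<delta> :: real
  assumes "finite A"
    and few_bad: "\<And>r. card {S. S \<subseteq> A \<and> card S = r \<and> \<not> good (V r) (u r) S} \<le> \<delta> * (card A choose r)"
  shows "card (bad_family A V u) \<le> \<delta> * 2 ^ card A"
proof (rule card_le_of_layers[OF assms(1)])
  show "bad_family A V u \<subseteq> Pow A" by (auto simp: bad_family_def)
  fix r
  have "{S \<in> bad_family A V u. card S = r} = {S. S \<subseteq> A \<and> card S = r \<and> \<not> good (V r) (u r) S}"
    by (auto simp: bad_family_def)
  then show "card {S \<in> bad_family A V u. card S = r} \<le> \<delta> * (card A choose r)"
    by (simp only: few_bad)
qed

lemma bad_family_meets_layers:
  assumes V: "\<And>r. finite (V r)" "\<And>r. subspace (V r)" "\<And>r. dim (V r) = r"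
    and u: "\<And>r. u r \<in> A \<rightarrow> V r \<times> V r"
    and A: "finite A" "R \<subseteq> A" "X \<subseteq> A" "R \<inter> X = {}"
    and s: "2 \<le> s" "s + 2 \<le> card X" "CARD('f) \<le> s \<or> CARD('f) + s \<le> card X"
  shows "\<exists>Y\<subseteq>X. card Y = s \<and> R \<union> Y \<in> bad_family A V u"
proof -
  define r where "r = card R + s"
  have fin: "finite R" "finite X" using A by (auto intro: finite_subset)
  have labels: "u r ` (R \<union> X) \<subseteq> V r \<times> V r"
    using A by (intro image_subsetI funcset_mem[OF u]) auto
  have "card R + s = dim (V r)" by (simp add: V(3) r_def)
  from not_all_good[OF V(1,2) fin labels this s]
  obtain Y where Y: "Y \<subseteq> X" "card Y = s" "\<not> good (V r) (u r) (R \<union> Y)" by blast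
  have "finite Y" "R \<inter> Y = {}" using Y(1) A(4) fin(2) by (auto intro: finite_subset)
  then have "card (R \<union> Y) = r" using fin(1) Y(2) by (simp add: card_Un_disjoint r_def)
  moreover have "R \<union> Y \<subseteq> A" using Y(1) A by blast
  ultimately show ?thesis using Y by (auto simp: bad_family_def)
qed

lemma exists_sparse_family_meeting_layers:
  fixes \<delta> :: real
  assumes inf: "infinite (UNIV :: 'a set)" and A: "finite A"
    and \<delta>: "\<And>r. \<delta> \<le> good_density CARD('f) r"
  obtains \<B> where "\<B> \<subseteq> Pow A" "card \<B> \<le> (1 - \<delta>) * 2 ^ card A"
    "\<And>R X s. R \<subseteq> A \<Longrightarrow> X \<subseteq> A \<Longrightarrow> R \<inter> X = {} \<Longrightarrow> 2 \<le> s \<Longrightarrow> s + 2 \<le> card X \<Longrightarrow>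
      CARD('f) \<le> s \<or> CARD('f) + s \<le> card X \<Longrightarrow> \<exists>Y\<subseteq>X. card Y = s \<and> R \<union> Y \<in> \<B>"
proof -
  have "\<exists>V. finite V \<and> subspace V \<and> dim V = r" for r
    using exists_subspace_of_dim[OF inf] by metis
  then obtain V where V: "\<And>r. finite (V r)" "\<And>r. subspace (V r)" "\<And>r. dim (V r) = r" by metis
  have "\<forall>r. \<exists>u. u \<in> A \<rightarrow>\<^sub>E V r \<times> V r \<and> card {S. S \<subseteq> A \<and> card S = r \<and> \<not> good (V r) u S} \<le>
      (1 - good_density CARD('f) r) * (card A choose r)"
    using exists_labelling_with_few_bad[OF V(1,2) A] unfolding V(3) by blast
  from choice[OF this] obtain u where u: "\<And>r. u r \<in> A \<rightarrow>\<^sub>E V r \<times> V r"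
    and few_bad: "\<And>r. card {S. S \<subseteq> A \<and> card S = r \<and> \<not> good (V r) (u r) S} \<le>
      (1 - good_density CARD('f) r) * (card A choose r)"
    by blast
  have "(1 - good_density CARD('f) r) * (card A choose r) \<le> (1 - \<delta>) * (card A choose r)" for r
    using \<delta> by (intro mult_right_mono) simp_all
  then have "card {S. S \<subseteq> A \<and> card S = r \<and> \<not> good (V r) (u r) S} \<le>
      (1 - \<delta>) * (card A choose r)" for r
    using few_bad by (rule order_trans[rotated])
  then have sparse: "card (bad_family A V u) \<le> (1 - \<delta>) * 2 ^ card A"
    by (rule card_bad_family_le[OF A])
  have funcset: "u r \<in> A \<rightarrow> V r \<times> V r" for r using u[of r] by (simp add: PiE_iff Pi_iff)
  show thesis
  proof (rule that[OF _ sparse])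
    show "bad_family A V u \<subseteq> Pow A" by (auto simp: bad_family_def)
  qed (rule bad_family_meets_layers[OF V funcset A])
qed

end

section \<open>Hitting sets of the cube\<close>

lemma hitting_number_le_card:
  assumes \<B>: "\<B> \<subseteq> Pow {1..n}"
    and hits: "\<And>R X. R \<subseteq> {1..n} \<Longrightarrow> X \<subseteq> {1..n} \<Longrightarrow> R \<inter> X = {} \<Longrightarrow> card X = d \<Longrightarrow>
      \<exists>Y\<subseteq>X. R \<union> Y \<in> \<B>"
  shows "hitting_number n d \<le> card \<B>"
proof -
  define vertex where "vertex S = (\<lambda>i\<in>{1..n}. if i \<in> S then 1 else 0 :: nat)" for S
  have vertex_cube: "vertex S \<in> cube n" for S by (auto simp: vertex_def cube_def)
  have "vertex ` \<B> \<inter> C \<noteq> {}" if C: "C \<in> subcubes n d" for C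
  proof -
    obtain I b where C: "C = {x \<in> cube n. \<forall>i\<in>{1..n} - I. x i = b i}"
      and I: "I \<subseteq> {1..n}" "card I = d" and b: "b \<in> {1..n} - I \<rightarrow> {0, 1}"
      using C unfolding subcubes_def by blast
    define R where "R = {i \<in> {1..n} - I. b i = 1}"
    have "\<exists>Y\<subseteq>I. R \<union> Y \<in> \<B>" using I by (intro hits) (auto simp: R_def)
    then obtain Y where Y: "Y \<subseteq> I" "R \<union> Y \<in> \<B>" by blast
    have "vertex (R \<union> Y) i = b i" if "i \<in> {1..n} - I" for i
      using that Y(1) b by (auto simp: R_def vertex_def)
    then have "vertex (R \<union> Y) \<in> C" using vertex_cube by (simp add: C)
    with Y(2) show ?thesis by blast
  qed
  then have "hitting_number n d \<le> card (vertex ` \<B>)"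
    using vertex_cube by (intro hitting_number_lower) auto
  also have "\<dots> \<le> card \<B>"
    using \<B> by (intro card_image_le) (auto intro: finite_subset)
  finally show ?thesis .
qed

lemma exists_small_residue_class:
  assumes "finite \<B>" "0 < p"
  obtains a where "a < p" "p * card {S \<in> \<B>. f S mod p = a} \<le> card \<B>"
proof (rule ccontr)
  assume "\<not> thesis"
  with that have "card \<B> < p * card {S \<in> \<B>. f S mod p = a}" if "a < p" for a
    using that by (meson not_le)
  then have "(\<Sum>a<p. card \<B>) < (\<Sum>a<p. p * card {S \<in> \<B>. f S mod p = a})"
    using assms(2) by (intro sum_strict_mono) auto
  also have "\<dots> = p * card \<B>"
    using assms card_eq_sum_card_fibres[of \<B> "{..<p}" "\<lambda>S. f S mod p"]
    by (simp add: sum_distrib_left image_subset_iff)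
  finally show False by simp
qed

lemma exists_shift_to_residue:
  fixes a k l p :: nat
  assumes "a < p"
  obtains s where "l \<le> s" "s < l + p" "(k + s) mod p = a"
proof -
  have "(k + (l + (a + (p - 1) * (k + l)) mod p)) mod p = (k + l + (a + (p - 1) * (k + l))) mod p"
    by (metis add.assoc mod_add_right_eq)
  also have "k + l + (a + (p - 1) * (k + l)) = a + p * (k + l)"
    using assms by (cases p) simp_all
  also have "\<dots> mod p = a" using assms by simp
  finally show thesis using assms that[of "l + (a + (p - 1) * (k + l)) mod p"] by simp
qed

lemma (in finite_field_vector_space) hitting_number_le:
  fixes \<delta> :: real
  assumes inf: "infinite (UNIV :: 'a set)" and d: "4 \<le> d" "2 * CARD('f) \<le> d + 1"
    and \<delta>: "\<And>r. \<delta> \<le> good_density CARD('f) r"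
  shows "real (d - 3) * hitting_number n d \<le> (1 - \<delta>) * 2 ^ n"
proof -
  obtain \<B> where \<B>: "\<B> \<subseteq> Pow {1..n}" "card \<B> \<le> (1 - \<delta>) * 2 ^ n"
    and meets: "\<And>R X s. R \<subseteq> {1..n} \<Longrightarrow> X \<subseteq> {1..n} \<Longrightarrow> R \<inter> X = {} \<Longrightarrow> 2 \<le> s \<Longrightarrow> s + 2 \<le> card X \<Longrightarrow>
      CARD('f) \<le> s \<or> CARD('f) + s \<le> card X \<Longrightarrow> \<exists>Y\<subseteq>X. card Y = s \<and> R \<union> Y \<in> \<B>"
    using exists_sparse_family_meeting_layers[OF inf _ \<delta>, of "{1..n}"]
    by (metis card_atLeastAtMost diff_Suc_1 finite_atLeastAtMost)
  have "finite \<B>" using \<B>(1) by (rule finite_subset) simp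
  moreover have "0 < d - 3" using d(1) by simp
  ultimately obtain a where a: "a < d - 3" "(d - 3) * card {S \<in> \<B>. card S mod (d - 3) = a} \<le> card \<B>"
    by (rule exists_small_residue_class)
  have "hitting_number n d \<le> card {S \<in> \<B>. card S mod (d - 3) = a}"
  proof (rule hitting_number_le_card)
    fix R X :: "nat set"
    assume RX: "R \<subseteq> {1..n}" "X \<subseteq> {1..n}" "R \<inter> X = {}" "card X = d"
    obtain s where s: "2 \<le> s" "s < 2 + (d - 3)" "(card R + s) mod (d - 3) = a"
      by (rule exists_shift_to_residue[OF a(1)])
    have "CARD('f) \<le> s \<or> CARD('f) + s \<le> d" using d(2) by linarith
    moreover have "s + 2 \<le> d" using s(2) d(1) by linarith
    ultimately obtain Y where Y: "Y \<subseteq> X" "card Y = s" "R \<union> Y \<in> \<B>"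
      using meets[OF RX(1-3) s(1)] RX(4) by blast
    have "finite R" "finite Y" using RX(1,2) Y(1) finite_subset[of _ "{1..n}"] by auto
    then have "card (R \<union> Y) = card R + s"
      using RX(3) Y(1,2) by (subst card_Un_disjoint) auto
    with Y s(3) show "\<exists>Y\<subseteq>X. R \<union> Y \<in> {S \<in> \<B>. card S mod (d - 3) = a}" by auto
  qed (use \<B>(1) in auto)
  then have "(d - 3) * hitting_number n d \<le> card \<B>" using a(2) by (meson le_trans mult_le_mono2)
  then have "real (d - 3) * hitting_number n d \<le> card \<B>" by (metis of_nat_le_iff of_nat_mult)
  with \<B>(2) show ?thesis by linarith
qed

section \<open>The field with three elements\<close>

lemma good_density_3_ge: "5715 / 10000 \<le> good_density 3 r"
proof -
  have \<phi>_small: "gl_density 3 0 = 1" "gl_density 3 (Suc 0) = 2 / 3" "gl_density 3 2 = 16 / 27"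
    "gl_density 3 3 = 416 / 729" "gl_density 3 4 = 33280 / 59049"
    "gl_density 3 5 = 8053760 / 14348907"
    by (simp_all add: gl_density_def eval_nat_numeral)
  consider (small) "r = 0 \<or> r = 1 \<or> r = 2 \<or> r = 3 \<or> r = 4" | (large) "5 \<le> r" by linarith
  then show ?thesis
  proof cases
    case small
    then show ?thesis
      by (elim disjE) (simp_all add: good_density_def \<phi>_small power2_eq_square)
  next
    case large
    define x :: real where "x = 1 / 3 ^ r"
    have "(3::real) ^ 5 \<le> 3 ^ r" using large by (intro power_increasing) auto
    then have x: "0 \<le> x" "x \<le> 1 / 243" by (simp_all add: x_def field_simps)
    have \<phi>: "8053760 / 14348907 * (485 / 486) \<le> gl_density 3 r"
      using gl_density_ge[of 3 5 r] large by (simp add: \<phi>_small)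
    define m where "m = r - 2"
    then have m: "r = Suc (Suc m)" using large by simp
    have "gl_density 3 r = gl_density 3 (r - 2) * ((1 - x) * (1 - 3 * x))"
      by (simp add: m x_def gl_density_Suc)
    then have ratio: "(1 - x) * (1 - 3 * x) = gl_density 3 r / gl_density 3 (r - 2)"
      using gl_density_pos[of 3 "r - 2"] by simp
    have "good_density 3 r = gl_density 3 r * (1 + (1 - x) * (1 - 3 * x) / 48)"
      using large unfolding ratio
      by (simp add: good_density_def \<phi>_small power2_eq_square distrib_left)
    moreover have "242 / 243 * (240 / 243) \<le> (1 - x) * (1 - 3 * x)"
      using x by (intro mult_mono) auto
    then have "8053760 / 14348907 * (485 / 486) * (1 + 242 / 243 * (240 / 243) / 48) \<le>
        gl_density 3 r * (1 + (1 - x) * (1 - 3 * x) / 48)"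
      using \<phi> by (intro mult_mono) auto
    ultimately show ?thesis by simp
  qed
qed

lemma vector_space_smult: "vector_space (smult :: 'a :: field \<Rightarrow> _)"
  by unfold_locales (simp_all add: smult_add_right smult_add_left)

lemma hitting_number_6_le: "3 * real (hitting_number n 6) \<le> 4285 / 10000 * 2 ^ n"
proof -
  interpret finite_field_vector_space "smult :: Enum.finite_3 \<Rightarrow> _"
    by (intro finite_field_vector_space.intro vector_space_smult)
  have "inj (monom (1 :: Enum.finite_3))" by (rule injI) (metis degree_monom_eq one_neq_zero)
  then have "infinite (UNIV :: Enum.finite_3 poly set)"
    by (metis infinite_UNIV_nat finite_imageD finite_subset subset_UNIV)
  moreover have "CARD(Enum.finite_3) = 3" by (simp add: Enum.UNIV_finite_3)
  ultimately show ?thesis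
    using hitting_number_le[of 6 "5715 / 10000" n] good_density_3_ge by simp
qed

theorem theorem6:
  "vertex_turan_density 6 > 6 / 7 \<and> hitting_density 6 < 1 / 7"
proof -
  have "hitting_density 6 \<le> 4285 / 30000"
    using hitting_number_6_le
    by (intro LIMSEQ_le_const2[OF hitting_density_tendsto]) (auto simp: field_simps)
  then show ?thesis using hitting_density_eq[of 6] by simp
qed

end
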